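(* A configuration $(\sigma,\tau,\tau_1,\rho_c,\rho_e,x,y,z)$ of the Professor's Cube (the $5\times5\times5$ Rubik's Cube) is valid if and only if all of the following hold: (1) $\operatorname{sgn}(\sigma)=\operatorname{sgn}(\tau)=\operatorname{sgn}(\rho_c)$; (2) $\operatorname{sgn}(\tau_1)=\operatorname{sgn}(\sigma)\operatorname{sgn}(\rho_e)$; (3) $\sum_i x_i\equiv 0\pmod 3$; (4) $\sum_i z_i\equiv 0\pmod 2$; (5) $y_{i_{t,s}}=1-\delta_{t,s}$ for $i=1,\dots,12$ (for every coupled edge $i_{t,s}$, $t,s\in\{a,b\}$), where $\delta_{a,a}=\delta_{b,b}=1$ and $\delta_{a,b}=\delta_{b,a}=0$.
   Context: Cube and moves. The Professor's Cube is the $5\times5\times5$ Rubik's Cube. Place its centre at the origin; cubies have integer coordinates in $\{-2,\dots,2\}^3$. The generating moves are the clockwise quarter turns $R,L,F,B,U,D$ of the six outer slices (faces right, left, front, back, up, down) and the quarter turns $C_R,C_L,C_F,C_B,C_U,C_D$ of the internal slices adjacent to these outer slices (at distance 1 from the centre of the cube). The most central cubie of each face is fixed. Let $\mathbf G_5\subset S_{150}$ be the group of permutations of the 150 stickers generated by these moves. Pieces. There are 8 corner cubies (3 stickers), 36 edge cubies (2 stickers) and 54 center cubies (1 sticker). The 12 single edges are the edge cubies at the midpoints of the edges of the cube; the remaining 24 edge cubies are coupled edges, forming 12 pairs, one pair on each edge of the cube. On each face there are, besides the fixed central cubie, 4 center corners (on the diagonals through the fixed center; 24 in total) and 4 center edges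 (adjacent to the sides of the fixed center; 24 in total). All coupled edges, center corners and center edges are labelled, so all pieces are distinguishable. Coupled edge types and orientations. For each of the 12 edges of the cube choose as reference side the U or D side if the edge bounds the U or D face, and the R or L side otherwise. Looking from outside at the face containing the reference side, turned so that the edge in question is its bottom side, the right-hand position of the pair is the $a$-position and the left-hand one is the $b$-position. Spatial positions of coupled edges are denoted $i_t$, $i=1,\dots,12$, $t\in\{a,b\}$. The type $s\in\{a,b\}$ of a coupled edge cubie is the type of the position it occupies in the solved cube; its reference sticker is the one lying on the reference side in the solved cube. The symbol $i_{t,s}$ denotes the coupled edge in position $i_t$, of type $s$, and $y_{i_{t,s}}:=y_{i_t}\in\mathbb Z_2$ is its orientation: $0$ if its reference sticker lies on the reference side of its present position, and $1$ otherwise. Single edges have orientations in $\mathbb Z_2$ defined in the same way by reference stickers and reference sides. Configurations. A configuration is an arbitrary placement of the labelled pieces into positions of the same kind (corners, single edges, coupled edges, center corners, center edges), with arbitrary orientations of corners and edges (individual edge cubies, including coupled ones, may be flipped). It is identified with an 8-tuple $(\sigma,\tau,\tau_1,\rho_c,\rho_e,x,y,z)$, where $\sigma\in S_8$, $\tau\in S_{12}$, $\tau_1\in S_{24}$, $\rho_c\in S_{24}$, $\rho_e\in S_{24}$ are the permutations of corners, single edges, coupled edges, center corners and center edges; $x\in(\mathbb Z_3)^8$ gives the corner orientations ($x_i$ is the clockwise twist, in units of $120^\circ$, of a corner's U/D-coloured sticker relative to the U/D side of the corner position it occupies); $y\in(\mathbb Z_2)^{24}$ and $z\in(\mathbb Z_2)^{12}$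 give the orientations of coupled and single edges. The group $\mathbf G_5$ acts on the set of configurations by composition in $S_{150}$. The initial configuration is the one with all permutations equal to the identity and all vectors equal to $0$. A configuration is valid if it lies in the orbit of the initial configuration under $\mathbf G_5$. *)

theory Defs
  imports
    "HOL-Library.FuncSet"
    "HOL-Library.Product_Plus"
    "HOL-Combinatorics.Permutations"
    "HOL-Number_Theory.Cong"
    "HOL-Algebra.Generated_Groups"
begin

section \<open>Stickers and moves\<close>

text \<open>
  Coordinates are right-handed: the faces R, U, F have outward normals
  (1,0,0), (0,1,0), (0,0,1), and L, D, B the opposite ones.
\<close>

type_synonym vec = "int \<times> int \<times> int"

fun dot :: "vec \<Rightarrow> vec \<Rightarrow> int" where
  "dot (a, b, c) (x, y, z) = a * x + b * y + c * z"

fun cross :: "vec \<Rightarrow> vec \<Rightarrow> vec" where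
  "cross (a, b, c) (x, y, z) = (b * z - c * y, c * x - a * z, a * y - b * x)"

fun scale :: "int \<Rightarrow> vec \<Rightarrow> vec" where
  "scale k (x, y, z) = (k * x, k * y, k * z)"

definition normals :: "vec set" where
  "normals = {(1,0,0), (-1,0,0), (0,1,0), (0,-1,0), (0,0,1), (0,0,-1)}"

text \<open>
  A sticker place is a pair of the coordinates of a cubie and the outward normal of the
  face it lies on. A sticker is named by the place it has in the solved cube.
\<close>

type_synonym sticker = "vec \<times> vec"

definition stickers :: "sticker set" where
  "stickers = {(p, n). p \<in> {-2..2} \<times> {-2..2} \<times> {-2..2} \<and> n \<in> normals \<and> dot p n = 2}"

text \<open>The rotation by 90 degrees about a unit vector \<open>n\<close>, clockwise when looking
  from the tip of \<open>n\<close> towards the origin.\<close>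

definition clockwise :: "vec \<Rightarrow> vec \<Rightarrow> vec" where
  "clockwise n v = scale (dot v n) n + cross v n"

text \<open>The clockwise quarter turn of the slice at height \<open>k\<close> in direction \<open>n\<close>:
  the moves \<open>R, L, F, B, U, D\<close> have \<open>k = 2\<close>, and
  \<open>C\<^sub>R, C\<^sub>L, C\<^sub>F, C\<^sub>B, C\<^sub>U, C\<^sub>D\<close> have \<open>k = 1\<close>.\<close>

definition quarter_turn :: "vec \<Rightarrow> int \<Rightarrow> sticker \<Rightarrow> sticker" where
  "quarter_turn n k = (\<lambda>(p, d).
     if (p, d) \<in> stickers \<and> dot p n = k then (clockwise n p, clockwise n d) else (p, d))"

definition sticker_perms :: "(sticker \<Rightarrow> sticker) monoid" where
  "sticker_perms = \<lparr>carrier = {f. f permutes stickers}, mult = (\<circ>), one = id\<rparr>"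

definition G5 :: "(sticker \<Rightarrow> sticker) set" where
  "G5 = generate sticker_perms {quarter_turn n k | n k. n \<in> normals \<and> k \<in> {1, 2}}"


section \<open>Pieces\<close>

fun abs_coords :: "vec \<Rightarrow> int list" where
  "abs_coords (x, y, z) = sort [\<bar>x\<bar>, \<bar>y\<bar>, \<bar>z\<bar>]"

definition corners :: "vec set" where "corners = {p. abs_coords p = [2, 2, 2]}"
definition single_edges :: "vec set" where "single_edges = {p. abs_coords p = [0, 2, 2]}"
definition coupled_edges :: "vec set" where "coupled_edges = {p. abs_coords p = [1, 2, 2]}"
definition center_corners :: "vec set" where "center_corners = {p. abs_coords p = [1, 1, 2]}"
definition center_edges :: "vec set" where "center_edges = {p. abs_coords p = [0, 1, 2]}"

text \<open>
  The sides of a cubie position. For an edge position the first entry is the reference side: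
  U/D if present, and R/L otherwise. For a corner position the list starts with the U/D side
  and proceeds clockwise as seen from outside (for instance U, R, F but U, F, L).
\<close>

fun sides :: "vec \<Rightarrow> vec list" where
  "sides (x, y, z) =
    (let X = (if \<bar>x\<bar> = 2 then [(sgn x, 0, 0)] else []);
         Y = (if \<bar>y\<bar> = 2 then [(0, sgn y, 0)] else []);
         Z = (if \<bar>z\<bar> = 2 then [(0, 0, sgn z)] else [])
     in if \<bar>y\<bar> = 2 \<and> x * y * z < 0 then Y @ Z @ X else Y @ X @ Z)"

datatype etype = A | B

text \<open>
  The twelve edges of the cube are named by their midpoints, the single edge positions.
  With \<open>r\<close> the reference side of edge \<open>i\<close> and \<open>s\<close> its other side, a viewer facing side \<open>r\<close>
  with the direction \<open>s\<close> pointing down has \<open>cross r s\<close> on the right.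
\<close>

definition coupled_pos :: "vec \<Rightarrow> etype \<Rightarrow> vec" where
  "coupled_pos i t =
    (let d = cross (sides i ! 0) (sides i ! 1) in case t of A \<Rightarrow> i + d | B \<Rightarrow> i - d)"


section \<open>Configurations\<close>

text \<open>
  The index sets of the permutations and of the orientation vectors are the sets of positions
  themselves. A permutation maps the home position of a piece to the position it occupies;
  an orientation vector is indexed by the occupied positions.
\<close>

type_synonym config =
  "(vec \<Rightarrow> vec) \<times> (vec \<Rightarrow> vec) \<times> (vec \<Rightarrow> vec) \<times> (vec \<Rightarrow> vec) \<times> (vec \<Rightarrow> vec) \<times>
   (vec \<Rightarrow> nat) \<times> (vec \<Rightarrow> nat) \<times> (vec \<Rightarrow> nat)"

definition configurations :: "config set" where
  "configurations = {(\<sigma>, \<tau>, \<tau>\<^sub>1, \<rho>\<^sub>c, \<rho>\<^sub>e, x, y, z).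
     \<sigma> permutes corners \<and> \<tau> permutes single_edges \<and> \<tau>\<^sub>1 permutes coupled_edges \<and>
     \<rho>\<^sub>c permutes center_corners \<and> \<rho>\<^sub>e permutes center_edges \<and>
     x \<in> corners \<rightarrow>\<^sub>E {..<3} \<and> y \<in> coupled_edges \<rightarrow>\<^sub>E {..<2} \<and> z \<in> single_edges \<rightarrow>\<^sub>E {..<2}}"

definition initial_config :: config where
  "initial_config =
    (id, id, id, id, id, \<lambda>_\<in>corners. 0, \<lambda>_\<in>coupled_edges. 0, \<lambda>_\<in>single_edges. 0)"

text \<open>The piece with home \<open>p\<close> is put into position \<open>q\<close> with orientation \<open>k\<close>: its sticker on the
  \<open>j\<close>-th side of \<open>p\<close> goes to the \<open>(k + j)\<close>-th side of \<open>q\<close>, counted cyclically.\<close>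

definition put :: "vec \<Rightarrow> nat \<Rightarrow> sticker \<Rightarrow> sticker" where
  "put q k = (\<lambda>(p, d). (q, the (map_of (zip (sides p) (rotate k (sides q))) d)))"

text \<open>The permutation of the stickers that takes the solved cube to a given configuration.\<close>

definition placement :: "config \<Rightarrow> sticker \<Rightarrow> sticker" where
  "placement = (\<lambda>(\<sigma>, \<tau>, \<tau>\<^sub>1, \<rho>\<^sub>c, \<rho>\<^sub>e, x, y, z) (p, d).
     if (p, d) \<notin> stickers then (p, d)
     else if p \<in> corners then put (\<sigma> p) (x (\<sigma> p)) (p, d)
     else if p \<in> single_edges then put (\<tau> p) (z (\<tau> p)) (p, d)
     else if p \<in> coupled_edges then put (\<tau>\<^sub>1 p) (y (\<tau>\<^sub>1 p)) (p, d)
     else if p \<in> center_corners then put (\<rho>\<^sub>c p) 0 (p, d)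
     else if p \<in> center_edges then put (\<rho>\<^sub>e p) 0 (p, d)
     else (p, d))"

definition valid :: "config \<Rightarrow> bool" where
  "valid c \<longleftrightarrow> (\<exists>g \<in> G5. placement c = g \<circ> placement initial_config)"

text \<open>The coupled edge occupying position \<open>i\<^sub>t\<close> has type \<open>s\<close>.\<close>

definition occupant_type :: "(vec \<Rightarrow> vec) \<Rightarrow> vec \<Rightarrow> etype \<Rightarrow> etype \<Rightarrow> bool" where
  "occupant_type \<tau>\<^sub>1 i t s \<longleftrightarrow>
    (\<exists>j \<in> single_edges. \<tau>\<^sub>1 (coupled_pos j s) = coupled_pos i t)"

end

theory Submission
  imports Defs "HOL-Combinatorics.Orbits"
begin

text \<open>
  Every sticker permutation in the group moves whole pieces, so it is described by a permutation
  of the positions and an orientation for each position (\<open>arrange\<close>). Such arrangements compose as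
  in a wreath product, and the conditions of the theorem (\<open>legal\<close>) are closed under composition:
  signs are multiplicative, sums of orientations are additive, and the condition on coupled edges
  says that the orientation of a coupled edge is a coboundary, namely the sum modulo 2 of the
  types of its home and its present position. The twelve quarter turns satisfy the conditions, by a
  finite check, and hence all elements of the group do (\<open>G5_legal\<close>).

  Conversely, for each kind of piece there is a word in the moves that acts as a three-cycle on it
  and leaves the positions of all other pieces alone. The quarter turns act transitively on
  the pieces of a kind, and each of them sends a point of that three-cycle to a point of it. By a
  block argument all three-cycles of the kind are then obtained, and therefore all even permutations
  (\<open>even_perm_in\<close>, \<open>even_perm_attainable\<close>). The same block argument, applied to one word that
  twists two corners in opposite directions and one that flips two single edges, gives all pure
  twists with total twist zero (\<open>legal_twist\<close>).

  Given a configuration that satisfies the conditions, at most one outer and one inner quarter turn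
  make all five permutations even. Some element of the group has the same permutations; the
  difference is a pure twist. It has total twist zero on the corners and on the single edges, and it
  is trivial on the coupled edges, whose orientations are determined by their permutation.
\<close>

unbundle no m_inv_syntax

section \<open>Even permutations and three-cycles\<close>

text \<open>The three-cycle \<open>a \<mapsto> b \<mapsto> c \<mapsto> a\<close>, for distinct \<open>a\<close>, \<open>b\<close>, \<open>c\<close>.\<close>

definition cyc3 :: "'a \<Rightarrow> 'a \<Rightarrow> 'a \<Rightarrow> 'a \<Rightarrow> 'a" where
  "cyc3 a b c = transpose a b \<circ> transpose b c"

lemma cyc3_apply:
  assumes "distinct [a, b, c]"
  shows "cyc3 a b c x = (if x = a then b else if x = b then c else if x = c then a else x)"
  using assms by (auto simp: cyc3_def transpose_def)

lemma permutation_cyc3: "permutation (cyc3 a b c)"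
  unfolding cyc3_def by (intro permutation_compose permutation_swap_id)

lemma evenperm_cyc3: "distinct [a, b, c] \<Longrightarrow> evenperm (cyc3 a b c)"
  unfolding cyc3_def by (simp add: evenperm_comp permutation_swap_id evenperm_swap)

lemma cyc3_permutes: "a \<in> X \<Longrightarrow> b \<in> X \<Longrightarrow> c \<in> X \<Longrightarrow> cyc3 a b c permutes X"
  unfolding cyc3_def by (intro permutes_compose permutes_swap_id)

lemma cyc3_rotate: "distinct [a, b, c] \<Longrightarrow> cyc3 b c a = cyc3 a b c"
  by (rule ext) (auto simp: cyc3_apply)

lemma inv_cyc3:
  assumes "distinct [a, b, c]"
  shows "inv (cyc3 a b c) = cyc3 c b a"
proof (rule inv_unique_comp)
  have "distinct [c, b, a]" using assms by auto
  then show "cyc3 a b c \<circ> cyc3 c b a = id" "cyc3 c b a \<circ> cyc3 a b c = id"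
    using assms by (auto simp: fun_eq_iff cyc3_apply)
qed

lemma conj_cyc3:
  assumes "bij f" "distinct [a, b, c]"
  shows "f \<circ> cyc3 a b c \<circ> inv f = cyc3 (f a) (f b) (f c)"
proof
  fix x
  obtain y where x: "x = f y" using assms(1) by (metis bij_pointE)
  have "distinct [f a, f b, f c]"
    using assms by (simp add: bij_is_inj inj_eq)
  then show "(f \<circ> cyc3 a b c \<circ> inv f) x = cyc3 (f a) (f b) (f c) x"
    using assms by (auto simp: x cyc3_apply bij_is_inj inj_eq)
qed

text \<open>The three-cycles on a finite set generate its alternating group, stated as an induction
  principle: a set of permutations that contains the identity and is closed under composition
  with three-cycles from the left contains all even permutations.\<close>

lemma even_perm_generated_by_cyc3:
  assumes fin: "finite X" and one: "id \<in> E"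
    and cyc: "\<And>a b c \<pi>. {a, b, c} \<subseteq> X \<Longrightarrow> distinct [a, b, c] \<Longrightarrow> \<pi> \<in> E \<Longrightarrow> cyc3 a b c \<circ> \<pi> \<in> E"
    and "\<pi> permutes X" "evenperm \<pi>"
  shows "\<pi> \<in> E"
  using assms(4,5)
proof (induction "card {p. \<pi> p \<noteq> p}" arbitrary: \<pi> rule: less_induct)
  case less
  note per = less.prems(1)
  show ?case
  proof (cases "\<pi> = id")
    case True
    then show ?thesis using one by simp
  next
    case False
    then obtain a where a: "\<pi> a \<noteq> a" by (auto simp: fun_eq_iff)
    define b where "b = \<pi> a"
    have ab: "a \<noteq> b" "\<pi> b \<noteq> b"
      using a per by (auto simp: b_def permutes_inj inj_eq)
    have "\<exists>c. c \<noteq> a \<and> c \<noteq> b \<and> \<pi> c \<noteq> c"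
    proof (rule ccontr)
      assume *: "\<not> ?thesis"
      have "\<pi> b = a"
      proof (rule ccontr)
        assume n: "\<pi> b \<noteq> a"
        then have "\<pi> (\<pi> b) = \<pi> b" using * ab(2) by blast
        then show False using ab(2) per by (simp add: permutes_inj inj_eq)
      qed
      then have "\<pi> = transpose a b"
        using * by (auto simp: fun_eq_iff transpose_def b_def)
      then show False using less.prems(2) ab by (simp add: evenperm_swap)
    qed
    then obtain c where c: "c \<noteq> a" "c \<noteq> b" "\<pi> c \<noteq> c" by blast
    have in_X: "{a, b, c} \<subseteq> X"
      using per a ab c by (auto simp: permutes_def)
    have d: "distinct [a, b, c]" "distinct [c, b, a]" using ab c by auto
    \<comment> \<open>Composing with this cycle sends \<open>b = \<pi> a\<close> back to \<open>a\<close> and moves only points that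
      \<open>\<pi>\<close> moves already.\<close>
    define \<rho> where "\<rho> = cyc3 c b a \<circ> \<pi>"
    have \<pi>: "\<pi> = cyc3 a b c \<circ> \<rho>"
      using d by (auto simp: \<rho>_def fun_eq_iff cyc3_apply)
    have \<rho>p: "\<rho> permutes X"
      unfolding \<rho>_def using per in_X by (intro permutes_compose cyc3_permutes) auto
    have "permutation \<pi>" using per fin permutation_permutes by blast
    then have \<rho>e: "evenperm \<rho>"
      using less.prems(2) d unfolding \<rho>_def
      by (simp add: evenperm_comp permutation_cyc3 evenperm_cyc3)
    have "\<rho> a = a" using d by (simp add: \<rho>_def cyc3_apply b_def[symmetric])
    moreover have "\<rho> p = p" if "\<pi> p = p" for p
      using that a ab c d by (auto simp: \<rho>_def cyc3_apply)
    ultimately have "{p. \<rho> p \<noteq> p} \<subset> {p. \<pi> p \<noteq> p}" using a by blast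
    moreover have "finite {p. \<pi> p \<noteq> p}"
      using per fin by (metis (mono_tags, lifting) finite_subset mem_Collect_eq permutes_not_in subsetI)
    ultimately have "card {p. \<rho> p \<noteq> p} < card {p. \<pi> p \<noteq> p}" by (rule psubset_card_mono[rotated])
    then have "\<rho> \<in> E" using less.hyps \<rho>p \<rho>e by blast
    then show ?thesis using \<pi> cyc[OF in_X d(1)] by simp
  qed
qed

text \<open>A symmetric and transitive relation \<open>R\<close> that is preserved by the generators \<open>\<Gamma>\<close> has blocks as
  its classes. If every generator sends some point of a subset \<open>S\<close> of the class of \<open>a\<close> to a
  point of \<open>S\<close>, then it maps the class into itself. As the action is transitive, there is
  only one class.\<close>

lemma block_is_everything:
  assumes trans: "\<And>p q r. R p q \<Longrightarrow> R q r \<Longrightarrow> R p r" and sym: "\<And>p q. R p q \<Longrightarrow> R q p"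
    and inva: "\<And>\<gamma> p q. \<gamma> \<in> \<Gamma> \<Longrightarrow> R p q \<Longrightarrow> R (\<gamma> p) (\<gamma> q)"
    and transitive: "\<And>K. a \<in> K \<Longrightarrow> (\<And>\<gamma> p. \<gamma> \<in> \<Gamma> \<Longrightarrow> p \<in> K \<Longrightarrow> \<gamma> p \<in> K) \<Longrightarrow> X \<subseteq> K"
    and S: "a \<in> S" "\<And>p. p \<in> S \<Longrightarrow> R a p"
    and meet: "\<And>\<gamma>. \<gamma> \<in> \<Gamma> \<Longrightarrow> \<exists>p\<in>S. \<gamma> p \<in> S"
    and "q \<in> X"
  shows "R a q"
proof -
  have "X \<subseteq> {p. R a p}"
  proof (rule transitive)
    show "a \<in> {p. R a p}" using S by simp
  next
    fix \<gamma> p assume \<gamma>: "\<gamma> \<in> \<Gamma>" and p: "p \<in> {p. R a p}"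
    obtain k where k: "k \<in> S" "\<gamma> k \<in> S" using meet[OF \<gamma>] by blast
    have "R (\<gamma> k) (\<gamma> p)" using k p S \<gamma> inva sym trans by blast
    then show "\<gamma> p \<in> {p. R a p}" using k S trans by blast
  qed
  then show ?thesis using \<open>q \<in> X\<close> by blast
qed

text \<open>A group \<open>E\<close> of permutations of a finite set \<open>X\<close>.\<close>

locale permutation_subgroup =
  fixes X :: "'a set" and E :: "('a \<Rightarrow> 'a) set"
  assumes fin: "finite X"
    and perm: "\<pi> \<in> E \<Longrightarrow> \<pi> permutes X"
    and id_in: "id \<in> E"
    and comp_in: "\<pi> \<in> E \<Longrightarrow> \<rho> \<in> E \<Longrightarrow> \<pi> \<circ> \<rho> \<in> E"
    and inv_in: "\<pi> \<in> E \<Longrightarrow> inv \<pi> \<in> E"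
begin

unbundle no m_inv_syntax

lemma conj_in:
  assumes "\<rho> \<in> E" "cyc3 a b c \<in> E" "distinct [a, b, c]"
  shows "cyc3 (\<rho> a) (\<rho> b) (\<rho> c) \<in> E"
  using assms comp_in inv_in conj_cyc3 perm permutes_bij by metis

lemma cyc3_inverse_in: "cyc3 a b c \<in> E \<Longrightarrow> distinct [a, b, c] \<Longrightarrow> cyc3 c b a \<in> E"
  using inv_in inv_cyc3 by metis

text \<open>Two points are linked if they are equal or lie together on a three-cycle in \<open>E\<close>. This is an
  equivalence relation: two three-cycles with a common point produce, by conjugation, a
  three-cycle through any two of their points.\<close>

definition linked :: "'a \<Rightarrow> 'a \<Rightarrow> bool" where
  "linked a b \<longleftrightarrow> a = b \<or> (\<exists>c. distinct [a, b, c] \<and> cyc3 a b c \<in> E)"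

lemma linked_sym: "linked a b \<Longrightarrow> linked b a"
  unfolding linked_def by (metis cyc3_inverse_in cyc3_rotate distinct_length_2_or_more distinct_rev rev.simps append.simps)

lemma linked_trans:
  assumes "linked a b" "linked b d"
  shows "linked a d"
proof (cases "a = b \<or> b = d \<or> a = d")
  case True
  then show ?thesis using assms by (auto simp: linked_def)
next
  case False
  then obtain c e where c: "distinct [a, b, c]" "cyc3 a b c \<in> E"
    and e: "distinct [b, d, e]" "cyc3 b d e \<in> E"
    using assms by (auto simp: linked_def)
  show ?thesis
  proof (cases "e = a")
    case True
    then have "cyc3 a b d \<in> E" using e cyc3_rotate[of a b d] by auto
    then have "cyc3 d b a \<in> E" using cyc3_inverse_in False by auto
    then have "cyc3 a d b \<in> E" using cyc3_rotate[of a d b] cyc3_rotate[of d b a] False by auto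
    then show ?thesis using False by (auto simp: linked_def)
  next
    case e_a: False
    have "cyc3 (cyc3 b d e a) (cyc3 b d e b) (cyc3 b d e c) \<in> E"
      using conj_in[OF e(2) c(2,1)] .
    moreover have "cyc3 b d e a = a" "cyc3 b d e b = d"
      using e e_a c False by (auto simp: cyc3_apply)
    moreover have "distinct [a, d, cyc3 b d e c]"
      using c e e_a False by (auto simp: cyc3_apply)
    ultimately show ?thesis unfolding linked_def by auto
  qed
qed

text \<open>If all points are linked, then \<open>E\<close> has a three-cycle \<open>p \<mapsto> q \<mapsto> c\<close> for some \<open>c\<close>,
  and a three-cycle \<open>c \<mapsto> r \<mapsto> e\<close> that moves its third point to \<open>r\<close> by conjugation. The
  conjugation has to go in the other direction if \<open>e\<close> is \<open>p\<close> or \<open>q\<close>.\<close>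

lemma cyc3_in_if_linked:
  assumes all: "\<And>p q. p \<in> X \<Longrightarrow> q \<in> X \<Longrightarrow> linked p q"
    and X: "p \<in> X" "q \<in> X" "r \<in> X" and d: "distinct [p, q, r]"
  shows "cyc3 p q r \<in> E"
proof -
  obtain c where c: "distinct [p, q, c]" "cyc3 p q c \<in> E"
    using all[OF X(1,2)] d by (auto simp: linked_def)
  show ?thesis
  proof (cases "c = r")
    case True
    then show ?thesis using c by simp
  next
    case cr: False
    have "c \<in> X"
      using perm[OF c(2)] c(1) by (metis cyc3_apply distinct_length_2_or_more permutes_not_in)
    then obtain e where e: "distinct [c, r, e]" "cyc3 c r e \<in> E"
      using all[OF _ X(3)] cr by (auto simp: linked_def)
    have fwd: "cyc3 (cyc3 c r e p) (cyc3 c r e q) (cyc3 c r e c) \<in> E"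
      using conj_in[OF e(2) c(2,1)] .
    have e': "cyc3 e r c \<in> E" "distinct [e, r, c]" using cyc3_inverse_in e by auto
    have bwd: "cyc3 (cyc3 e r c p) (cyc3 e r c q) (cyc3 e r c c) \<in> E"
      using conj_in[OF e'(1) c(2,1)] .
    consider "e = p" | "e = q" | "e \<noteq> p" "e \<noteq> q" by blast
    then show ?thesis
    proof cases
      case 1
      then have "cyc3 r q p \<in> E" using bwd e' c d by (auto simp: cyc3_apply)
      then show ?thesis using cyc3_inverse_in d by auto
    next
      case 2
      then have "cyc3 p r q \<in> E" using bwd e' c d by (auto simp: cyc3_apply)
      then have "cyc3 q r p \<in> E" using cyc3_inverse_in d by auto
      then show ?thesis using cyc3_rotate[of p q r] cyc3_rotate[of q r p] d by auto
    next
      case 3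
      then show ?thesis using fwd e c d by (auto simp: cyc3_apply)
    qed
  qed
qed

text \<open>The criterion used for each kind of piece. One three-cycle in \<open>E\<close> is enough, if \<open>E\<close> is
  normalized by a transitive set \<open>\<Gamma>\<close> of permutations each of which maps a point of the
  three-cycle to a point of it.\<close>

theorem even_perm_in:
  assumes conj: "\<And>\<gamma> \<pi>. \<gamma> \<in> \<Gamma> \<Longrightarrow> \<pi> \<in> E \<Longrightarrow> \<gamma> \<circ> \<pi> \<circ> inv \<gamma> \<in> E"
    and bij: "\<And>\<gamma>. \<gamma> \<in> \<Gamma> \<Longrightarrow> bij \<gamma>"
    and transitive: "\<And>K. a \<in> K \<Longrightarrow> (\<And>\<gamma> p. \<gamma> \<in> \<Gamma> \<Longrightarrow> p \<in> K \<Longrightarrow> \<gamma> p \<in> K) \<Longrightarrow> X \<subseteq> K"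
    and cyc: "distinct [a, b, c]" "cyc3 a b c \<in> E"
    and meet: "\<And>\<gamma>. \<gamma> \<in> \<Gamma> \<Longrightarrow> \<exists>p\<in>{a, b, c}. \<gamma> p \<in> {a, b, c}"
    and \<pi>: "\<pi> permutes X" "evenperm \<pi>"
  shows "\<pi> \<in> E"
proof -
  have "cyc3 c b a \<in> E" using cyc cyc3_inverse_in by blast
  then have "cyc3 a c b \<in> E"
    using cyc3_rotate[of a c b] cyc3_rotate[of c b a] cyc(1) by auto
  then have start: "linked a p" if "p \<in> {a, b, c}" for p
    using that cyc by (auto simp: linked_def)
  have inva: "linked (\<gamma> p) (\<gamma> q)" if \<gamma>: "\<gamma> \<in> \<Gamma>" and "linked p q" for \<gamma> p q
  proof (cases "p = q")
    case True
    then show ?thesis by (simp add: linked_def)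
  next
    case False
    then obtain r where r: "distinct [p, q, r]" "cyc3 p q r \<in> E"
      using \<open>linked p q\<close> by (auto simp: linked_def)
    then have "cyc3 (\<gamma> p) (\<gamma> q) (\<gamma> r) \<in> E"
      using conj[OF \<gamma> r(2)] conj_cyc3[OF bij[OF \<gamma>] r(1)] by simp
    moreover have "distinct [\<gamma> p, \<gamma> q, \<gamma> r]"
      using r(1) bij[OF \<gamma>] by (auto dest: bij_is_inj simp: inj_eq)
    ultimately show ?thesis by (auto simp: linked_def)
  qed
  have "linked a q" if "q \<in> X" for q
    by (rule block_is_everything[where S = "{a, b, c}" and \<Gamma> = \<Gamma> and R = linked])
       (fact linked_trans linked_sym inva transitive start meet that | simp)+
  then have "linked p q" if "p \<in> X" "q \<in> X" for p q
    using that linked_sym linked_trans by blast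
  then show ?thesis
    using even_perm_generated_by_cyc3[OF fin id_in _ \<pi>] cyc3_in_if_linked comp_in by auto
qed

end

section \<open>Positions and stickers\<close>

declare abs_coords.simps [simp del] sides.simps [simp del]
  split_paired_All [simp del] split_paired_Ex [simp del]

text \<open>All positions, as a list, so that statements about all positions can be checked by evaluation.\<close>

definition cube_list :: "vec list" where
  "cube_list = List.product [-2..2] (List.product [-2..2] [-2..2])"

text \<open>The positions of the movable pieces; the central cubies of the faces are left out.\<close>

definition pieces :: "vec set" where
  "pieces = corners \<union> single_edges \<union> coupled_edges \<union> center_corners \<union> center_edges"

definition kinds :: "vec set set" where
  "kinds = {corners, single_edges, coupled_edges, center_corners, center_edges}"

lemma set_cube_list: "set cube_list = {-2..2} \<times> {-2..2} \<times> {-2..2}"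
  by (simp add: cube_list_def del: upto_rec_numeral)

lemma set_abs_coords: "set (abs_coords (x, y, z)) = {\<bar>x\<bar>, \<bar>y\<bar>, \<bar>z\<bar>}"
  by (simp add: abs_coords.simps del: sort_key_simps)

lemma kind_eq_list:
  assumes "set l \<subseteq> {0..2}"
  shows "{p. abs_coords p = l} = set (filter (\<lambda>p. abs_coords p = l) cube_list)"
proof -
  have "p \<in> set cube_list" if "abs_coords p = l" for p
  proof -
    obtain x y z where p: "p = (x, y, z)" by (cases p)
    have "set (abs_coords p) \<subseteq> {0..2}" using that assms by simp
    then show ?thesis by (auto simp: p set_cube_list set_abs_coords abs_le_iff)
  qed
  then show ?thesis by auto
qed

lemmas kind_defs = corners_def single_edges_def coupled_edges_def center_corners_def center_edges_def

lemma kinds_eq_list: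
  "corners = set (filter (\<lambda>p. abs_coords p = [2,2,2]) cube_list)"
  "single_edges = set (filter (\<lambda>p. abs_coords p = [0,2,2]) cube_list)"
  "coupled_edges = set (filter (\<lambda>p. abs_coords p = [1,2,2]) cube_list)"
  "center_corners = set (filter (\<lambda>p. abs_coords p = [1,1,2]) cube_list)"
  "center_edges = set (filter (\<lambda>p. abs_coords p = [0,1,2]) cube_list)"
  unfolding kind_defs by (rule kind_eq_list; simp)+

lemma finite_kind: "T \<in> kinds \<Longrightarrow> finite T"
  by (auto simp: kinds_def kinds_eq_list)

lemma kind_cases:
  assumes "T \<in> kinds" obtains l where "T = {p. abs_coords p = l}"
  using assms by (auto simp: kinds_def kind_defs)

lemma kind_subset_pieces: "T \<in> kinds \<Longrightarrow> T \<subseteq> pieces"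
  by (auto simp: kinds_def pieces_def)

lemma pieces_subset_cube: "pieces \<subseteq> set cube_list"
  by (auto simp: pieces_def kinds_eq_list)

lemma distinct_sides: "distinct (sides p)"
  by (cases p) (auto simp: sides.simps Let_def sgn_if)

lemma length_sides_abs: "length (sides p) = length (filter (\<lambda>k. k = 2) (abs_coords p))"
  by (cases p) (auto simp: sides.simps abs_coords.simps Let_def filter_sort simp del: sort_key_simps)

lemma length_sides_kind:
  "p \<in> corners \<Longrightarrow> length (sides p) = 3"
  "p \<in> single_edges \<Longrightarrow> length (sides p) = 2"
  "p \<in> coupled_edges \<Longrightarrow> length (sides p) = 2"
  "p \<in> center_corners \<Longrightarrow> length (sides p) = 1"
  "p \<in> center_edges \<Longrightarrow> length (sides p) = 1"
  by (simp_all add: length_sides_abs kind_defs)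

lemma length_sides_pieces: "p \<in> pieces \<Longrightarrow> length (sides p) \<in> {1, 2, 3}"
  unfolding pieces_def using length_sides_kind[of p] by auto

definition normal_list :: "vec list" where
  "normal_list = [(1,0,0), (-1,0,0), (0,1,0), (0,-1,0), (0,0,1), (0,0,-1)]"

lemma normals_eq_list: "normals = set normal_list"
  by (simp add: normals_def normal_list_def)

lemma sides_table: "list_all (\<lambda>p. list_all (\<lambda>d. (dot p d = 2) = (d \<in> set (sides p))) normal_list \<and>
    list_all (\<lambda>d. d \<in> set normal_list) (sides p)) cube_list"
  by code_simp

lemma stickers_iff: "(p, d) \<in> stickers \<longleftrightarrow> p \<in> set cube_list \<and> d \<in> set (sides p)"
  using sides_table unfolding list_all_iff stickers_def set_cube_list normals_eq_list by fastforce

section \<open>Arrangements of the pieces\<close>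

text \<open>The sticker permutation that moves the piece at \<open>p\<close> to \<open>\<pi> p\<close> and gives it the orientation
  \<open>w (\<pi> p)\<close>. A single permutation \<open>\<pi>\<close> and a single function \<open>w\<close> serve all kinds of
  pieces. Orientations are natural numbers that matter only modulo the number of sides of the
  piece.\<close>

definition arrange :: "(vec \<Rightarrow> vec) \<Rightarrow> (vec \<Rightarrow> nat) \<Rightarrow> sticker \<Rightarrow> sticker" where
  "arrange \<pi> w = (\<lambda>(p, d).
     if p \<in> pieces \<and> d \<in> set (sides p) then put (\<pi> p) (w (\<pi> p)) (p, d) else (p, d))"

text \<open>The permutations of the pieces that preserve their kind.\<close>

definition layout :: "(vec \<Rightarrow> vec) \<Rightarrow> bool" where
  "layout \<pi> \<longleftrightarrow> \<pi> permutes pieces \<and> (\<forall>p. abs_coords (\<pi> p) = abs_coords p)"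

lemma layout_id: "layout id" by (simp add: layout_def permutes_id)

lemma layout_comp: "layout \<pi> \<Longrightarrow> layout \<rho> \<Longrightarrow> layout (\<pi> \<circ> \<rho>)"
  by (auto simp: layout_def intro: permutes_compose)

lemma layout_inv: "layout \<pi> \<Longrightarrow> layout (inv \<pi>)"
  unfolding layout_def by (metis permutes_inv permutes_inverses(1))

lemma layout_bij: "layout \<pi> \<Longrightarrow> bij \<pi>" by (auto simp: layout_def permutes_bij)

lemma layout_pieces: "layout \<pi> \<Longrightarrow> \<pi> p \<in> pieces \<longleftrightarrow> p \<in> pieces"
  by (auto simp: layout_def permutes_in_image)

lemma layout_kind: "layout \<pi> \<Longrightarrow> T \<in> kinds \<Longrightarrow> \<pi> p \<in> T \<longleftrightarrow> p \<in> T"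
  by (elim kind_cases) (auto simp: layout_def)

lemma layout_length: "layout \<pi> \<Longrightarrow> length (sides (\<pi> p)) = length (sides p)"
  by (auto simp: layout_def length_sides_abs)

lemma layout_if_permutes_kind: "\<pi> permutes T \<Longrightarrow> T \<in> kinds \<Longrightarrow> layout \<pi>"
  unfolding layout_def using kind_subset_pieces permutes_subset
  by (metis (mono_tags, lifting) kind_cases mem_Collect_eq permutes_in_image permutes_not_in)

lemma put_nth:
  assumes "length (sides q) = length (sides p)" "j < length (sides p)"
  shows "put q k (p, sides p ! j) = (q, sides q ! ((k + j) mod length (sides q)))"
  using assms by (simp add: put_def map_of_zip_nth distinct_sides nth_rotate)

lemma arrange_nth:
  assumes "layout \<pi>" "p \<in> pieces" "j < length (sides p)"
  shows "arrange \<pi> w (p, sides p ! j) =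
    (\<pi> p, sides (\<pi> p) ! ((w (\<pi> p) + j) mod length (sides p)))"
  using assms by (simp add: arrange_def put_nth layout_length)

lemma arrange_outside: "p \<notin> pieces \<Longrightarrow> arrange \<pi> w (p, d) = (p, d)"
  "d \<notin> set (sides p) \<Longrightarrow> arrange \<pi> w (p, d) = (p, d)"
  by (auto simp: arrange_def)

lemma sticker_eqI:
  fixes f g :: "sticker \<Rightarrow> sticker"
  assumes "\<And>p j. p \<in> pieces \<Longrightarrow> j < length (sides p) \<Longrightarrow> f (p, sides p ! j) = g (p, sides p ! j)"
    and "\<And>p d. p \<notin> pieces \<or> d \<notin> set (sides p) \<Longrightarrow> f (p, d) = g (p, d)"
  shows "f = g"
proof
  fix s :: sticker
  obtain p d where s: "s = (p, d)" by (cases s)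
  show "f s = g s"
  proof (cases "p \<in> pieces \<and> d \<in> set (sides p)")
    case True
    then show ?thesis using assms(1) by (metis in_set_conv_nth s)
  qed (use assms(2) s in auto)
qed

text \<open>Arrangements compose as in a wreath product.\<close>

lemma arrange_comp:
  assumes "layout \<pi>" "layout \<rho>"
  shows "arrange \<pi> v \<circ> arrange \<rho> w = arrange (\<pi> \<circ> \<rho>) (\<lambda>q. v q + w (inv \<pi> q))"
proof (rule sticker_eqI)
  fix p j assume p: "p \<in> pieces" "j < length (sides p)"
  have "inv \<pi> (\<pi> (\<rho> p)) = \<rho> p" using assms layout_bij by (simp add: bij_is_inj)
  moreover have "(w (\<rho> p) + j) mod length (sides p) < length (sides (\<rho> p))"
    using p assms layout_length[of \<rho> p] mod_less_divisor[of "length (sides p)"] by fastforce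
  ultimately show "(arrange \<pi> v \<circ> arrange \<rho> w) (p, sides p ! j) =
      arrange (\<pi> \<circ> \<rho>) (\<lambda>q. v q + w (inv \<pi> q)) (p, sides p ! j)"
    using assms p
    by (simp add: arrange_nth layout_comp layout_pieces layout_length mod_simps ac_simps)
qed (auto simp: arrange_outside)

lemma arrange_cong:
  assumes "layout \<pi>" "\<And>q. q \<in> pieces \<Longrightarrow> [v q = w q] (mod length (sides q))"
  shows "arrange \<pi> v = arrange \<pi> w"
proof (rule sticker_eqI)
  fix p j assume p: "p \<in> pieces" "j < length (sides p)"
  have "[v (\<pi> p) + j = w (\<pi> p) + j] (mod length (sides p))"
    using assms(2)[of "\<pi> p"] p assms(1) by (simp add: layout_pieces layout_length cong_add_rcancel_nat)
  then show "arrange \<pi> v (p, sides p ! j) = arrange \<pi> w (p, sides p ! j)"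
    using assms(1) p by (simp add: arrange_nth cong_def)
qed (auto simp: arrange_outside)

text \<open>The permutation and, modulo the number of sides, the orientations are determined by the sticker
  permutation.\<close>

lemma arrange_eqD:
  assumes "layout \<pi>" "layout \<rho>" and eq: "arrange \<pi> v = arrange \<rho> w"
  shows "\<pi> = \<rho>" "q \<in> pieces \<Longrightarrow> [v q = w q] (mod length (sides q))"
proof -
  have main: "\<pi> p = \<rho> p \<and> [v (\<pi> p) = w (\<pi> p)] (mod length (sides p))" if p: "p \<in> pieces" for p
  proof -
    have l: "0 < length (sides p)" using length_sides_pieces[OF p] by auto
    have *: "\<pi> p = \<rho> p" "sides (\<pi> p) ! (v (\<pi> p) mod length (sides p)) = sides (\<pi> p) ! (w (\<pi> p) mod length (sides p))"
      using fun_cong[OF eq, of "(p, sides p ! 0)"] arrange_nth[OF assms(1) p l, of v]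
        arrange_nth[OF assms(2) p l, of w] by (auto simp del: length_greater_0_conv)
    then show ?thesis
      using l layout_length[OF assms(1), of p] layout_length[OF assms(2), of p]
      by (simp add: nth_eq_iff_index_eq distinct_sides cong_def)
  qed
  show "\<pi> = \<rho>"
    using main assms(1,2) by (metis ext layout_def permutes_not_in)
  show "[v q = w q] (mod length (sides q))" if "q \<in> pieces" for q
  proof -
    have "inv \<pi> q \<in> pieces" "\<pi> (inv \<pi> q) = q"
      using assms(1) that layout_pieces[OF layout_inv] layout_bij
      by (auto simp: bij_is_surj surj_f_inv_f)
    then show ?thesis using main[of "inv \<pi> q"] layout_length[OF assms(1), of "inv \<pi> q"] by metis
  qed
qed

lemma arrange_id: "arrange id (\<lambda>_. 0) = id"
  by (rule sticker_eqI) (auto simp: arrange_nth layout_id arrange_outside)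

section \<open>The invariants\<close>

text \<open>The edge of the cube on which a coupled edge position lies, named by its single edge position.\<close>

fun midpoint :: "vec \<Rightarrow> vec" where
  "midpoint (x, y, z) =
    (if \<bar>x\<bar> = 1 then 0 else x, if \<bar>y\<bar> = 1 then 0 else y, if \<bar>z\<bar> = 1 then 0 else z)"

text \<open>The type of a coupled edge position as a bit: \<open>0\<close> for \<open>a\<close> and \<open>1\<close> for \<open>b\<close>. The orientation
  of a coupled edge is then, modulo 2, the sum of the types of its home and of its present
  position.\<close>

definition b_type :: "vec \<Rightarrow> nat" where
  "b_type p = (if p = coupled_pos (midpoint p) A then 0 else 1)"

text \<open>The sign of the permutation that \<open>\<pi>\<close> induces on the pieces of the kind \<open>T\<close>.\<close>

abbreviation sgn_on :: "vec set \<Rightarrow> (vec \<Rightarrow> vec) \<Rightarrow> int" where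
  "sgn_on T \<pi> \<equiv> sign (perm_restrict \<pi> T)"

text \<open>The conditions of the theorem, expressed by the combined permutation and orientations.\<close>

definition legal :: "(vec \<Rightarrow> vec) \<Rightarrow> (vec \<Rightarrow> nat) \<Rightarrow> bool" where
  "legal \<pi> w \<longleftrightarrow>
     sgn_on corners \<pi> = sgn_on single_edges \<pi> \<and>
     sgn_on single_edges \<pi> = sgn_on center_corners \<pi> \<and>
     sgn_on coupled_edges \<pi> = sgn_on corners \<pi> * sgn_on center_edges \<pi> \<and>
     [(\<Sum>q\<in>corners. w q) = 0] (mod 3) \<and>
     [(\<Sum>q\<in>single_edges. w q) = 0] (mod 2) \<and>
     (\<forall>p\<in>coupled_edges. [w (\<pi> p) = b_type p + b_type (\<pi> p)] (mod 2))"

lemma perm_restrict_permutes: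
  assumes "layout \<pi>" "T \<in> kinds"
  shows "perm_restrict \<pi> T permutes T"
proof (rule bij_imp_permutes)
  have "\<pi> ` T = T"
  proof (intro equalityI subsetI)
    fix p assume "p \<in> T"
    then have "p = \<pi> (inv \<pi> p)" "inv \<pi> p \<in> T"
      using assms layout_kind[OF layout_inv] layout_bij by (auto simp: bij_is_surj surj_f_inv_f)
    then show "p \<in> \<pi> ` T" by blast
  qed (use assms layout_kind in auto)
  moreover have "inj_on \<pi> T" using layout_bij[OF assms(1)] by (meson bij_is_inj inj_on_subset subset_UNIV)
  ultimately have "bij_betw \<pi> T T" by (simp add: bij_betw_def)
  then show "bij_betw (perm_restrict \<pi> T) T T"
    by (subst bij_betw_cong[where g = \<pi>]) (auto simp: perm_restrict_simps)
qed (simp add: perm_restrict_simps)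

lemma perm_restrict_comp_layout:
  assumes "layout \<rho>" "T \<in> kinds"
  shows "perm_restrict (\<pi> \<circ> \<rho>) T = perm_restrict \<pi> T \<circ> perm_restrict \<rho> T"
  using assms by (auto simp: fun_eq_iff perm_restrict_def layout_kind)

lemma sgn_on_comp:
  assumes "layout \<pi>" "layout \<rho>" "T \<in> kinds"
  shows "sgn_on T (\<pi> \<circ> \<rho>) = sgn_on T \<pi> * sgn_on T \<rho>"
  unfolding perm_restrict_comp_layout[OF assms(2,3)]
  using assms perm_restrict_permutes finite_kind permutation_permutes
  by (intro sign_compose) blast+

lemma sum_comp_inv:
  fixes w :: "vec \<Rightarrow> nat"
  assumes "layout \<pi>" "T \<in> kinds"
  shows "(\<Sum>q\<in>T. w (inv \<pi> q)) = (\<Sum>q\<in>T. w q)"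
proof -
  have "bij_betw (perm_restrict (inv \<pi>) T) T T"
    using perm_restrict_permutes[OF layout_inv[OF assms(1)] assms(2)] by (rule permutes_imp_bij)
  then have "bij_betw (inv \<pi>) T T"
    by (subst (asm) bij_betw_cong[where g = "inv \<pi>"]) (auto simp: perm_restrict_simps)
  then show ?thesis by (rule sum.reindex_bij_betw)
qed

lemma kindsI [simp]: "corners \<in> kinds" "single_edges \<in> kinds" "coupled_edges \<in> kinds"
  "center_corners \<in> kinds" "center_edges \<in> kinds"
  by (auto simp: kinds_def)

lemma legal_comp:
  assumes "layout \<pi>" "layout \<rho>" "legal \<pi> v" "legal \<rho> w"
  shows "legal (\<pi> \<circ> \<rho>) (\<lambda>q. v q + w (inv \<pi> q))"
proof -
  have "[v (\<pi> (\<rho> p)) + w (inv \<pi> (\<pi> (\<rho> p))) = b_type p + b_type (\<pi> (\<rho> p))] (mod 2)"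
    if "p \<in> coupled_edges" for p
  proof -
    have "[w (\<rho> p) = b_type p + b_type (\<rho> p)] (mod 2)"
      "[v (\<pi> (\<rho> p)) = b_type (\<rho> p) + b_type (\<pi> (\<rho> p))] (mod 2)"
      using assms that by (auto simp: legal_def layout_kind)
    then have "[v (\<pi> (\<rho> p)) + w (\<rho> p) =
        b_type (\<rho> p) + b_type (\<pi> (\<rho> p)) + (b_type p + b_type (\<rho> p))] (mod 2)"
      by (rule cong_add[rotated])
    also have "[b_type (\<rho> p) + b_type (\<pi> (\<rho> p)) + (b_type p + b_type (\<rho> p)) =
        b_type p + b_type (\<pi> (\<rho> p))] (mod 2)"
      by (simp add: cong_def) presburger
    finally show ?thesis using assms(1) by (simp add: layout_bij bij_is_inj)
  qed
  moreover have "[(\<Sum>q\<in>corners. v q + w (inv \<pi> q)) = 0 + 0] (mod 3)"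
    using assms by (simp only: sum.distrib sum_comp_inv kindsI, intro cong_add) (auto simp: legal_def)
  moreover have "[(\<Sum>q\<in>single_edges. v q + w (inv \<pi> q)) = 0 + 0] (mod 2)"
    using assms by (simp only: sum.distrib sum_comp_inv kindsI, intro cong_add) (auto simp: legal_def)
  ultimately show ?thesis
    using assms by (simp add: legal_def sgn_on_comp)
qed

lemma legal_id: "legal id (\<lambda>_. 0)"
proof -
  have "perm_restrict id T = (id :: vec \<Rightarrow> vec)" for T by (auto simp: perm_restrict_def)
  then show ?thesis by (simp add: legal_def cong_def sign_id)
qed

section \<open>The group of sticker permutations\<close>

lemma clockwise_four: "n \<in> normals \<Longrightarrow> clockwise n (clockwise n (clockwise n (clockwise n v))) = v"
  by (cases v) (auto simp: normals_def clockwise_def)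

lemma dot_clockwise: "n \<in> normals \<Longrightarrow> dot (clockwise n v) n = dot v n"
  by (cases v) (auto simp: normals_def clockwise_def)

lemma abs_coords_clockwise: "n \<in> normals \<Longrightarrow> abs_coords (clockwise n v) = abs_coords v"
  by (cases v) (auto simp: normals_def clockwise_def abs_coords.simps)

lemma stickers_clockwise: "n \<in> normals \<Longrightarrow> (p, d) \<in> stickers \<Longrightarrow> (clockwise n p, clockwise n d) \<in> stickers"
  by (cases p; cases d) (auto simp: normals_def clockwise_def stickers_def)

lemma quarter_turn_four:
  assumes n: "n \<in> normals"
  shows "(quarter_turn n k ^^ 4) s = s"
proof -
  obtain p d where s: "s = (p, d)" by (cases s)
  have four: "(f ^^ 4) x = f (f (f (f x)))" for f :: "sticker \<Rightarrow> sticker" and x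
  proof -
    have "(4::nat) = Suc (Suc (Suc (Suc 0)))" by simp
    then show ?thesis by (simp only: funpow.simps o_apply id_apply)
  qed
  show ?thesis
  proof (cases "(p, d) \<in> stickers \<and> dot p n = k")
    case True
    define moved where "moved x \<longleftrightarrow> x \<in> stickers \<and> dot (fst x) n = k" for x
    define step where "step x = (clockwise n (fst x), clockwise n (snd x))" for x
    have 1: "quarter_turn n k x = step x" "moved (step x)" if "moved x" for x
      using that n stickers_clockwise[of n "fst x" "snd x"]
      by (simp_all add: moved_def step_def quarter_turn_def case_prod_unfold dot_clockwise)
    have "moved s" using True by (simp add: s moved_def)
    then have "(quarter_turn n k ^^ 4) s = step (step (step (step s)))" unfolding four by (metis 1)
    also have "\<dots> = (clockwise n (clockwise n (clockwise n (clockwise n p))),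
        clockwise n (clockwise n (clockwise n (clockwise n d))))"
      by (simp only: s step_def fst_conv snd_conv)
    finally show ?thesis by (simp only: s clockwise_four[OF n])
  next
    case False
    then have "quarter_turn n k s = s" by (auto simp: s quarter_turn_def)
    then show ?thesis by (simp only: four)
  qed
qed

lemma permutes_if_periodic:
  assumes "\<And>x. (f ^^ Suc m) x = x" "\<And>x. x \<notin> S \<Longrightarrow> f x = x"
  shows "f permutes S"
  unfolding permutes_def
proof (intro conjI allI impI)
  fix y
  show "\<exists>!x. f x = y"
  proof (rule ex1I)
    show "f ((f ^^ m) y) = y" using assms(1) by simp
  next
    fix x assume "f x = y"
    then show "x = (f ^^ m) y" using assms(1)[of x] by (simp add: funpow_swap1)
  qed
qed (use assms(2) in simp)

lemma quarter_turn_permutes: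
  assumes "n \<in> normals" shows "quarter_turn n k permutes stickers"
proof (rule permutes_if_periodic)
  fix s show "(quarter_turn n k ^^ Suc 3) s = s"
    using quarter_turn_four[OF assms, of k s] by (simp only: Suc_numeral) simp
qed (auto simp: quarter_turn_def)

lemma sticker_perms_simps [simp]:
  "carrier sticker_perms = {f. f permutes stickers}"
  "f \<otimes>\<^bsub>sticker_perms\<^esub> g = f \<circ> g" "\<one>\<^bsub>sticker_perms\<^esub> = id"
  by (simp_all add: sticker_perms_def)

lemma group_sticker_perms: "group sticker_perms"
  by (rule groupI)
    (auto simp: permutes_compose permutes_id o_assoc intro: permutes_inv permutes_inv_o(2))

lemma m_inv_sticker_perms: "f permutes stickers \<Longrightarrow> m_inv sticker_perms f = inv f"
  by (rule group.inv_equality[OF group_sticker_perms])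
    (auto simp: permutes_inv permutes_inv_o(2))

abbreviation turns :: "(sticker \<Rightarrow> sticker) set" where
  "turns \<equiv> {quarter_turn n k | n k. n \<in> normals \<and> k \<in> {1, 2}}"

lemma turns_subset: "turns \<subseteq> carrier sticker_perms"
  using quarter_turn_permutes by auto

lemma G5_permutes: "g \<in> G5 \<Longrightarrow> g permutes stickers"
  using group.generate_in_carrier[OF group_sticker_perms turns_subset] by (auto simp: G5_def)

lemma id_in_G5: "id \<in> G5"
  using generate.one[of sticker_perms] by (simp add: G5_def)

lemma comp_in_G5: "g \<in> G5 \<Longrightarrow> h \<in> G5 \<Longrightarrow> g \<circ> h \<in> G5"
  using generate.eng[of g sticker_perms _ h] by (simp add: G5_def)

lemma inv_in_G5: "g \<in> G5 \<Longrightarrow> inv g \<in> G5"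
  using group.generate_m_inv_closed[OF group_sticker_perms turns_subset] m_inv_sticker_perms G5_permutes
  by (fastforce simp: G5_def)

lemma quarter_turn_in_G5: "n \<in> normals \<Longrightarrow> k \<in> {1, 2} \<Longrightarrow> quarter_turn n k \<in> G5"
  unfolding G5_def by (rule generate.incl) auto

lemma inv_quarter_turn:
  assumes "n \<in> normals"
  shows "inv (quarter_turn n k) = quarter_turn n k ^^ 3"
proof (rule inv_unique_comp)
  show "quarter_turn n k \<circ> quarter_turn n k ^^ 3 = id" "quarter_turn n k ^^ 3 \<circ> quarter_turn n k = id"
    using quarter_turn_four[OF assms, of k] by (auto simp: eval_nat_numeral fun_eq_iff)
qed

text \<open>No case for inverses is needed, as the inverse of a quarter turn is its cube.\<close>

lemma G5_induct [consumes 1, case_names id turn comp]: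
  assumes "g \<in> G5" "P id" "\<And>n k. n \<in> normals \<Longrightarrow> k \<in> {1, 2} \<Longrightarrow> P (quarter_turn n k)"
    and comp: "\<And>g h. P g \<Longrightarrow> P h \<Longrightarrow> P (g \<circ> h)"
  shows "P g"
  using assms(1) unfolding G5_def
proof (induction rule: generate.induct)
  case (inv h)
  then obtain n k where h: "h = quarter_turn n k" "n \<in> normals" "k \<in> {1, 2}" by blast
  have "P (h ^^ 3)" using assms(3)[OF h(2,3)] comp by (auto simp: h(1) eval_nat_numeral)
  then show ?case
    using h by (simp add: m_inv_sticker_perms quarter_turn_permutes inv_quarter_turn)
next
  case one
  then show ?case using assms(2) by (simp only: sticker_perms_simps)
next
  case (incl h)
  then show ?case using assms(3) by blast
next
  case (eng g h)
  then show ?case using comp by (simp only: sticker_perms_simps)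
qed

section \<open>Quarter turns and the necessity of the conditions\<close>

text \<open>The effect of a quarter turn on positions. This function and the others that are evaluated
  below take positions apart by pattern matching, so that the simplifier unfolds them on concrete
  positions only.\<close>

fun turn_at :: "vec \<Rightarrow> int \<Rightarrow> vec \<Rightarrow> vec" where
  "turn_at (a, b, c) k (x, y, z) =
    (if dot (x, y, z) (a, b, c) = k then clockwise (a, b, c) (x, y, z) else (x, y, z))"

lemma turn_at_eq: "turn_at n k p = (if dot p n = k then clockwise n p else p)"
  by (cases n; cases p) simp

declare turn_at.simps [simp del]

definition turn_pos :: "vec \<Rightarrow> int \<Rightarrow> vec \<Rightarrow> vec" where
  "turn_pos n k p = (if p \<in> pieces then turn_at n k p else p)"

text \<open>The orientation of the piece that a quarter turn brings to a position \<open>q\<close>: the index, among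
  the sides of \<open>q\<close>, of the side that receives the first side of the position the piece comes
  from, which is the image of \<open>q\<close> under three more quarter turns.\<close>

fun turn_ori :: "vec \<Rightarrow> int \<Rightarrow> vec \<Rightarrow> nat" where
  "turn_ori (a, b, c) k (x, y, z) =
    (if dot (x, y, z) (a, b, c) = k
     then length (takeWhile
       (\<lambda>d. d \<noteq> clockwise (a, b, c) (sides ((clockwise (a, b, c) ^^ 3) (x, y, z)) ! 0))
       (sides (x, y, z)))
     else 0)"

declare turn_ori.simps [simp del]

lemma kind_clockwise: "n \<in> normals \<Longrightarrow> T \<in> kinds \<Longrightarrow> clockwise n p \<in> T \<longleftrightarrow> p \<in> T"
  by (elim kind_cases) (auto simp: abs_coords_clockwise)

lemma pieces_clockwise: "n \<in> normals \<Longrightarrow> clockwise n p \<in> pieces \<longleftrightarrow> p \<in> pieces"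
  by (auto simp: pieces_def kind_clockwise)

lemma layout_turn_pos:
  assumes "n \<in> normals" shows "layout (turn_pos n k)"
proof -
  have "turn_pos n k permutes pieces"
  proof (rule permutes_if_periodic[where m = 3])
    fix x show "(turn_pos n k ^^ Suc 3) x = x"
      using assms by (auto simp: eval_nat_numeral turn_pos_def turn_at_eq dot_clockwise pieces_clockwise clockwise_four)
  qed (simp add: turn_pos_def)
  then show ?thesis
    using assms by (auto simp: layout_def turn_pos_def turn_at_eq abs_coords_clockwise)
qed

text \<open>The quarter turn about \<open>n\<close> on a list of moved positions, as a product of transpositions, three
  for each cycle \<open>p \<mapsto> q \<mapsto> r \<mapsto> s \<mapsto> p\<close>. Each cycle is taken into account once, at
  the first of its points in the list.\<close>

fun turn_transps :: "vec \<Rightarrow> vec list \<Rightarrow> (vec \<times> vec) list" where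
  "turn_transps n [] = []"
| "turn_transps n (p # ps) =
    (let q = clockwise n p; r = clockwise n q; s = clockwise n r in
     if q \<in> set ps \<and> r \<in> set ps \<and> s \<in> set ps then [(p, q), (q, r), (r, s)] @ turn_transps n ps else turn_transps n ps)"


text \<open>The positions of a kind as a list.\<close>

definition kind_list :: "int list \<Rightarrow> vec list" where
  "kind_list l = filter (\<lambda>p. abs_coords p = l) cube_list"

text \<open>The values of \<^const>\<open>abs_coords\<close> at the five kinds of pieces: corners, single edges, coupled
  edges, center corners, center edges.\<close>

definition shapes :: "int list list" where
  "shapes = [[2,2,2], [0,2,2], [1,2,2], [1,1,2], [0,1,2]]"

lemma distinct_kind_list: "distinct (kind_list l)"
  by (simp add: kind_list_def cube_list_def distinct_product del: upto_rec_numeral)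

lemma kind_lists:
  "corners = set (kind_list [2,2,2])" "single_edges = set (kind_list [0,2,2])"
  "coupled_edges = set (kind_list [1,2,2])" "center_corners = set (kind_list [1,1,2])"
  "center_edges = set (kind_list [0,1,2])"
  by (simp_all add: kinds_eq_list kind_list_def)

lemma pieces_iff: "p \<in> pieces \<longleftrightarrow> abs_coords p \<in> set shapes"
  by (auto simp: pieces_def kind_defs shapes_def)

text \<open>The kinds on which the turn of a slice is odd. A turn of an outer slice (\<open>k = 2\<close>) has two
  four-cycles on the coupled edges and one on every other kind. A turn of an inner slice
  (\<open>k = 1\<close>) has one on the coupled edges, two on the center corners and one on the center
  edges.\<close>

definition odd_turn :: "int \<Rightarrow> int list \<Rightarrow> bool" where
  "odd_turn k l \<longleftrightarrow> (if k = 1 then l \<in> {[1,2,2], [0,1,2]} else l \<noteq> [1,2,2])"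

text \<open>The product of a list of transpositions, in a form that is evaluated at concrete positions.\<close>

fun transps_at :: "(vec \<times> vec) list \<Rightarrow> vec \<Rightarrow> vec" where
  "transps_at [] (x, y, z) = (x, y, z)"
| "transps_at ((a, b) # ts) (x, y, z) =
    (let q = transps_at ts (x, y, z) in if q = a then b else if q = b then a else q)"

lemma transps_at_eq: "transps_at ts p = apply_transps ts p"
  by (induction ts p rule: transps_at.induct) (auto simp: transpose_def Let_def)

definition turn_list :: "(vec \<times> int) list" where
  "turn_list = List.product normal_list [1, 2]"

lemma set_turn_list: "(n, k) \<in> set turn_list \<longleftrightarrow> n \<in> normals \<and> k \<in> {1, 2}"
  by (simp add: turn_list_def normals_eq_list)

text \<open>On the positions \<open>ps\<close> of the kind \<open>l\<close>, the turn is the product of transpositions given by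
  \<^const>\<open>turn_transps\<close>, and its parity is the expected one.\<close>

fun cycles_ok :: "(vec \<times> int) \<times> int list \<times> vec list \<Rightarrow> bool" where
  "cycles_ok (((a, b, c), k), l, ps) =
    (let ts = turn_transps (a, b, c) (filter (\<lambda>p. dot p (a, b, c) = k) ps) in
     list_all (\<lambda>p. transps_at ts p = turn_at (a, b, c) k p) ps \<and>
     list_all (\<lambda>(a, b). a \<noteq> b \<and> a \<in> set ps \<and> b \<in> set ps) ts \<and>
     (odd (length ts) \<longleftrightarrow> odd_turn k l))"

lemma cycles_table: "list_all cycles_ok (List.product turn_list (map (\<lambda>l. (l, kind_list l)) shapes))"
  by code_simp

fun b_sum :: "vec \<Rightarrow> vec \<Rightarrow> nat" where
  "b_sum (x, y, z) (x', y', z') = b_type (x, y, z) + b_type (x', y', z')"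

lemma b_sum_eq: "b_sum p q = b_type p + b_type q"
  by (cases p; cases q) simp

text \<open>The invariants of orientations for a turn: \<open>ps\<close>, \<open>qs\<close> and \<open>rs\<close> are the positions of the
  corners, single edges and coupled edges.\<close>

fun ori_ok :: "(vec \<times> int) \<times> vec list \<times> vec list \<times> vec list \<Rightarrow> bool" where
  "ori_ok (((a, b, c), k), ps, qs, rs) \<longleftrightarrow>
     sum_list (map (turn_ori (a, b, c) k) ps) mod 3 = 0 \<and>
     sum_list (map (turn_ori (a, b, c) k) qs) mod 2 = 0 \<and>
     list_all (\<lambda>p. (turn_ori (a, b, c) k (turn_at (a, b, c) k p) +
       b_sum p (turn_at (a, b, c) k p)) mod 2 = 0) rs"

lemma ori_table: "list_all ori_ok (List.product turn_list
    [(kind_list [2,2,2], kind_list [0,2,2], kind_list [1,2,2])])"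
  by code_simp

text \<open>A sticker moved by the turn goes where the arrangement puts it.\<close>

fun sticker_ok :: "vec \<Rightarrow> int \<Rightarrow> vec \<Rightarrow> vec \<Rightarrow> bool" where
  "sticker_ok (a, b, c) k (x, y, z) (x', y', z') \<longleftrightarrow>
     (let q = clockwise (a, b, c) (x, y, z) in
      (q, clockwise (a, b, c) (x', y', z')) =
      (if abs_coords (x, y, z) \<in> set shapes
       then put q (turn_ori (a, b, c) k q) ((x, y, z), (x', y', z'))
       else ((x, y, z), (x', y', z'))))"

fun stickers_ok :: "vec \<Rightarrow> int \<Rightarrow> vec \<Rightarrow> bool" where
  "stickers_ok (a, b, c) k (x, y, z) \<longleftrightarrow>
     (if dot (x, y, z) (a, b, c) = k then list_all (sticker_ok (a, b, c) k (x, y, z)) (sides (x, y, z))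
      else True)"

fun turn_ok :: "vec \<times> int \<Rightarrow> bool" where
  "turn_ok ((a, b, c), k) = list_all (stickers_ok (a, b, c) k) cube_list"

lemma stickers_table: "list_all turn_ok turn_list"
  by code_simp

lemma put_self:
  assumes "d \<in> set (sides p)" shows "put p 0 (p, d) = (p, d)"
  using assms put_nth[of p p _ 0] by (auto simp: in_set_conv_nth)

lemma turn_ori_fixed: "dot p n \<noteq> k \<Longrightarrow> turn_ori n k p = 0"
  by (cases n; cases p) (simp add: turn_ori.simps)

lemma sticker_ok:
  assumes "(p, d) \<in> stickers" "n \<in> normals" "k \<in> {1, 2}"
  shows "(if dot p n = k then (clockwise n p, clockwise n d) else (p, d)) =
    (if p \<in> pieces then put (turn_at n k p) (turn_ori n k (turn_at n k p)) (p, d) else (p, d))"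
proof (cases "dot p n = k")
  case True
  have "turn_ok (n, k)"
    using stickers_table assms by (auto simp: list_all_iff set_turn_list)
  then have "stickers_ok n k p"
    using assms(1) by (cases n) (auto simp: list_all_iff stickers_iff)
  then have "sticker_ok n k p d"
    using assms(1) True by (cases n; cases p) (auto simp: list_all_iff stickers_iff)
  then show ?thesis
    using True by (cases n; cases p; cases d) (simp add: Let_def turn_at_eq pieces_iff split: if_splits)
next
  case False
  then show ?thesis using assms(1) by (simp add: turn_at_eq turn_ori_fixed put_self stickers_iff)
qed

lemma quarter_turn_eq_arrange:
  assumes "n \<in> normals" "k \<in> {1, 2}"
  shows "quarter_turn n k = arrange (turn_pos n k) (turn_ori n k)"
proof
  fix s :: sticker
  obtain p d where s: "s = (p, d)" by (cases s)
  show "quarter_turn n k s = arrange (turn_pos n k) (turn_ori n k) s"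
  proof (cases "s \<in> stickers")
    case True
    then show ?thesis
      using sticker_ok[of p d n k] assms
      by (simp add: s quarter_turn_def arrange_def turn_pos_def stickers_iff)
  next
    case False
    then show ?thesis
      using pieces_subset_cube by (auto simp: s quarter_turn_def arrange_def stickers_iff)
  qed
qed

text \<open>The signs are read off from the decompositions into transpositions.\<close>

lemma sgn_on_turn_pos:
  assumes "n \<in> normals" "k \<in> {1, 2}" "l \<in> set shapes"
  shows "sgn_on (set (kind_list l)) (turn_pos n k) = (if odd_turn k l then -1 else 1)"
proof -
  define ps where "ps = kind_list l"
  define ts where "ts = turn_transps n (filter (\<lambda>p. dot p n = k) ps)"
  have "cycles_ok ((n, k), l, ps)"
    using cycles_table assms by (auto simp: list_all_iff set_turn_list ps_def)
  then have *: "\<And>p. p \<in> set ps \<Longrightarrow> apply_transps ts p = turn_at n k p"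
    "\<And>a b. (a, b) \<in> set ts \<Longrightarrow> a \<noteq> b \<and> a \<in> set ps \<and> b \<in> set ps" "odd (length ts) \<longleftrightarrow> odd_turn k l"
    by (cases n; auto simp: list_all_iff ts_def Let_def transps_at_eq)+
  have "apply_transps ts permutes set ps"
    using *(2) by (intro permutes_apply_transps) auto
  moreover have "p \<in> pieces" if "p \<in> set ps" for p
    using that assms(3) by (simp add: ps_def kind_list_def pieces_iff)
  ultimately have "perm_restrict (turn_pos n k) (set ps) = apply_transps ts"
    using *(1) by (auto simp: fun_eq_iff perm_restrict_def turn_pos_def permutes_not_in)
  moreover have "evenperm (apply_transps ts) \<longleftrightarrow> even (length ts)"
    by (rule evenperm_apply_transps_iff) (use *(2) in fast)
  ultimately show ?thesis using *(3) by (cases "odd_turn k l") (simp_all add: sign_def ps_def)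
qed

lemma turn_signs:
  assumes "n \<in> normals" "k \<in> {1, 2}"
  shows "sgn_on corners (turn_pos n k) = (if k = 1 then 1 else -1)"
    "sgn_on single_edges (turn_pos n k) = (if k = 1 then 1 else -1)"
    "sgn_on coupled_edges (turn_pos n k) = (if k = 1 then -1 else 1)"
    "sgn_on center_corners (turn_pos n k) = (if k = 1 then 1 else -1)"
    "sgn_on center_edges (turn_pos n k) = -1"
  unfolding kind_lists using assms by (subst sgn_on_turn_pos; simp add: shapes_def odd_turn_def)+

lemma legal_turn:
  assumes "n \<in> normals" "k \<in> {1, 2}"
  shows "legal (turn_pos n k) (turn_ori n k)"
proof -
  have "ori_ok ((n, k), kind_list [2,2,2], kind_list [0,2,2], kind_list [1,2,2])"
    using ori_table assms by (auto simp: list_all_iff set_turn_list)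
  then have sums: "sum_list (map (turn_ori n k) (kind_list [2,2,2])) mod 3 = 0"
      "sum_list (map (turn_ori n k) (kind_list [0,2,2])) mod 2 = 0"
    and cpl: "\<And>p. p \<in> set (kind_list [1,2,2]) \<Longrightarrow>
      (turn_ori n k (turn_at n k p) + (b_type p + b_type (turn_at n k p))) mod 2 = 0"
    by (cases n; auto simp: list_all_iff b_sum_eq)+
  have "[(\<Sum>q\<in>corners. turn_ori n k q) = 0] (mod 3)" "[(\<Sum>q\<in>single_edges. turn_ori n k q) = 0] (mod 2)"
    using sums unfolding kind_lists cong_def
    by (simp_all add: sum_list_distinct_conv_sum_set distinct_kind_list)
  moreover have "[turn_ori n k (turn_pos n k p) = b_type p + b_type (turn_pos n k p)] (mod 2)"
    if p: "p \<in> coupled_edges" for p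
  proof -
    have "turn_pos n k p = turn_at n k p" using p by (simp add: turn_pos_def pieces_def)
    then show ?thesis using cpl[of p] p unfolding cong_def kind_lists(3) by simp presburger
  qed
  ultimately show ?thesis using turn_signs[OF assms] by (simp add: legal_def)
qed

text \<open>Necessity: every element of the group is an arrangement that satisfies the conditions.\<close>

theorem G5_legal:
  assumes "g \<in> G5"
  obtains \<pi> w where "layout \<pi>" "legal \<pi> w" "g = arrange \<pi> w"
proof -
  have "\<exists>\<pi> w. layout \<pi> \<and> legal \<pi> w \<and> g = arrange \<pi> w"
    using assms
  proof (induction rule: G5_induct)
    case id
    then show ?case using layout_id legal_id arrange_id by metis
  next
    case (turn n k)
    then show ?case using layout_turn_pos legal_turn quarter_turn_eq_arrange by blast
  next
    case (comp g h)
    then obtain \<pi> v \<rho> w where *: "layout \<pi>" "legal \<pi> v" "layout \<rho>" "legal \<rho> w"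
      and gh: "g = arrange \<pi> v" "h = arrange \<rho> w" by metis
    show ?case
      unfolding gh arrange_comp[OF *(1,3)]
      using layout_comp[OF *(1,3)] legal_comp[OF *(1,3,2,4)] by blast
  qed
  then show ?thesis using that by blast
qed

section \<open>Words for three-cycles and twists\<close>

text \<open>A letter \<open>(n, k)\<close> stands for the quarter turn of the slice at height \<open>k\<close> in direction \<open>n\<close>.
  Its opposite is the same slice described from the other side, turned the other way. Words are
  read from left to right.\<close>

fun opp :: "vec \<times> int \<Rightarrow> vec \<times> int" where
  "opp ((a, b, c), k) = ((-a, -b, -c), -k)"

definition inverse_word :: "(vec \<times> int) list \<Rightarrow> (vec \<times> int) list" where
  "inverse_word ws = rev (map opp ws)"

definition conj_word :: "(vec \<times> int) list \<Rightarrow> (vec \<times> int) list \<Rightarrow> (vec \<times> int) list" where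
  "conj_word xs ys = xs @ ys @ inverse_word xs"

definition comm_word :: "(vec \<times> int) list \<Rightarrow> (vec \<times> int) list \<Rightarrow> (vec \<times> int) list" where
  "comm_word xs ys = xs @ ys @ inverse_word xs @ inverse_word ys"

abbreviation (input) "turn_R \<equiv> ((1, 0, 0), 2)"
abbreviation (input) "turn_L \<equiv> ((-1, 0, 0), 2)"
abbreviation (input) "turn_U \<equiv> ((0, 1, 0), 2)"
abbreviation (input) "turn_D \<equiv> ((0, -1, 0), 2)"
abbreviation (input) "turn_B \<equiv> ((0, 0, -1), 2)"
abbreviation (input) "slice_R \<equiv> ((1, 0, 0), 1)"
abbreviation (input) "slice_L \<equiv> ((-1, 0, 0), 1)"
abbreviation (input) "slice_U \<equiv> ((0, 1, 0), 1)"
abbreviation (input) "slice_D \<equiv> ((0, -1, 0), 1)"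

text \<open>Here and in the next two words, the positions moved by the conjugated turn and those moved by
  the other turn have exactly one piece in common, so the commutator is a three-cycle.\<close>

definition corner_word :: "(vec \<times> int) list" where
  "corner_word = comm_word (conj_word [turn_R] [turn_U]) [turn_D]"

definition coupled_edge_word :: "(vec \<times> int) list" where
  "coupled_edge_word = comm_word (conj_word [turn_R] [turn_U]) [slice_U]"

definition center_corner_word :: "(vec \<times> int) list" where
  "center_corner_word = comm_word (conj_word [turn_R] [slice_U]) [slice_D]"

text \<open>A commutator of two intersecting slices whose fifth power is a three-cycle of center edges.\<close>

definition center_edge_word :: "(vec \<times> int) list" where
  "center_edge_word = concat (replicate 5 (comm_word [turn_R] [slice_U]))"

text \<open>Up to a rotation of the whole cube, turning all layers parallel to \<open>R\<close> but the middle one turns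
  the middle layer the other way, so the repeated word is a commutator of a turn of the middle layer
  with a half turn of an outer slice. It is a three-cycle on the single edges and a product of two
  transpositions on the center edges; hence its square is a three-cycle of single edges.\<close>

definition single_edge_word :: "(vec \<times> int) list" where
  "single_edge_word = concat (replicate 2
     (conj_word [turn_R, slice_R, opp turn_L, opp slice_L] [turn_B, turn_B] @ [turn_U, turn_U]))"

text \<open>The square of the commutator of the opposites of \<open>R\<close> and \<open>D\<close> changes only one piece of the
  upper layer, a corner that it twists in place. Its commutator with \<open>U\<close> twists two corners in opposite directions.\<close>

definition twist_word :: "(vec \<times> int) list" where
  "twist_word = comm_word [turn_U] (concat (replicate 2 (comm_word [opp turn_R] [opp turn_D])))"

text \<open>A conjugate of the three-cycle of single edges that permutes the same positions in the same way
  but with other orientations; the quotient of the two flips two edges.\<close>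

definition flip_word :: "(vec \<times> int) list" where
  "flip_word = conj_word [turn_D, opp turn_B, turn_L, turn_B] single_edge_word @
     inverse_word single_edge_word"

fun is_letter :: "vec \<times> int \<Rightarrow> bool" where
  "is_letter (n, k) \<longleftrightarrow> n \<in> set normal_list \<and> k \<in> set [1, 2, -1, -2]"

text \<open>On stickers this is \<^const>\<open>quarter_turn\<close>.\<close>

fun turn_sticker :: "vec \<times> int \<Rightarrow> sticker \<Rightarrow> sticker" where
  "turn_sticker ((a, b, c), k) ((x, y, z), d) =
    (if dot (x, y, z) (a, b, c) = k then (clockwise (a, b, c) (x, y, z), clockwise (a, b, c) d)
     else ((x, y, z), d))"

lemma turn_sticker_eq: "s \<in> stickers \<Longrightarrow> turn_sticker (n, k) s = quarter_turn n k s"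
  by (cases n; cases s) (auto simp: quarter_turn_def elim!: turn_sticker.elims)

lemma quarter_turn_opposite:
  assumes n: "(a, b, c) \<in> normals"
  shows "(-a, -b, -c) \<in> normals"
    and "quarter_turn (-a, -b, -c) (-k) (quarter_turn (a, b, c) k s) = s"
proof -
  show m: "(-a, -b, -c) \<in> normals" using n by (auto simp: normals_def)
  have *: "clockwise (-a, -b, -c) (clockwise (a, b, c) v) = v" for v
    using n by (cases v) (auto simp: normals_def clockwise_def)
  have dot: "dot v (-a, -b, -c) = - dot v (a, b, c)" for v by (cases v) simp
  obtain p d where s: "s = (p, d)" by (cases s)
  show "quarter_turn (-a, -b, -c) (-k) (quarter_turn (a, b, c) k s) = s"
  proof (cases "(p, d) \<in> stickers \<and> dot p (a, b, c) = k")
    case True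
    then have "quarter_turn (a, b, c) k s = (clockwise (a, b, c) p, clockwise (a, b, c) d)"
      by (simp add: s quarter_turn_def)
    moreover have "(clockwise (a, b, c) p, clockwise (a, b, c) d) \<in> stickers"
      "dot (clockwise (a, b, c) p) (-a, -b, -c) = -k"
      using True by (simp_all only: dot dot_clockwise[OF n] stickers_clockwise[OF n])
    ultimately show ?thesis
      by (simp only: quarter_turn_def prod.case simp_thms if_True * s)
  next
    case False
    then show ?thesis by (auto simp: s quarter_turn_def dot)
  qed
qed

lemma quarter_turn_letter:
  assumes "is_letter (n, k)" shows "quarter_turn n k \<in> G5"
proof -
  obtain a b c where abc: "n = (a, b, c)" by (cases n)
  have n: "(a, b, c) \<in> normals" and k: "k \<in> {1, 2} \<or> -k \<in> {1, 2}"
    using assms by (auto simp: normals_eq_list abc)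
  show ?thesis
  proof (cases "k \<in> {1, 2}")
    case True
    then show ?thesis using n quarter_turn_in_G5 by (simp add: abc)
  next
    case False
    have m: "(-a, -b, -c) \<in> normals" using quarter_turn_opposite(1)[OF n] .
    have "inv (quarter_turn (-a, -b, -c) (-k)) = quarter_turn n k"
      using quarter_turn_opposite(2)[OF n, of k] quarter_turn_opposite(2)[OF m, of "-k"]
      by (intro inv_unique_comp) (simp_all add: fun_eq_iff abc)
    then show ?thesis using inv_in_G5[OF quarter_turn_in_G5[OF m]] k False by metis
  qed
qed

lemma word_in_G5:
  assumes "list_all is_letter ws"
  obtains g where "g \<in> G5" "\<And>s. s \<in> stickers \<Longrightarrow> g s = fold turn_sticker ws s"
proof -
  have "\<exists>g\<in>G5. \<forall>s\<in>stickers. g s = fold turn_sticker ws s"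
    using assms
  proof (induction ws)
    case Nil
    then show ?case using id_in_G5 by (intro bexI[of _ id]) auto
  next
    case (Cons x ws)
    obtain n k where x: "x = (n, k)" by (cases x)
    obtain g where g: "g \<in> G5" "\<forall>s\<in>stickers. g s = fold turn_sticker ws s"
      using Cons by auto
    have q: "quarter_turn n k \<in> G5" using Cons.prems x by (intro quarter_turn_letter) simp
    have "quarter_turn n k s \<in> stickers" if "s \<in> stickers" for s
      using that G5_permutes[OF q] by (simp add: permutes_in_image)
    then show ?case
      using g comp_in_G5[OF g(1) q] by (intro bexI[of _ "g \<circ> quarter_turn n k"]) (auto simp: x turn_sticker_eq)
  qed
  then show ?thesis using that by blast
qed

definition piece_list :: "vec list" where
  "piece_list = concat (map kind_list shapes)"

lemma set_piece_list: "set piece_list = pieces"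
  by (auto simp: piece_list_def pieces_iff kind_list_def pieces_subset_cube[THEN subsetD])

text \<open>The orientations that twist the piece at \<open>a\<close> by \<open>1\<close> and the piece at \<open>b\<close> by \<open>-1\<close> modulo
  \<open>m\<close>. For \<open>a = b\<close> the two cancel modulo \<open>m\<close>.\<close>

definition pair_twist :: "nat \<Rightarrow> vec \<Rightarrow> vec \<Rightarrow> vec \<Rightarrow> nat" where
  "pair_twist m a b q = of_bool (q = a) + (m - 1) * of_bool (q = b)"

text \<open>The word moves pieces as the three-cycle does. It suffices to follow one sticker of each piece,
  as elements of the group are arrangements.\<close>

fun cycle_ok :: "(vec \<times> int) list \<times> vec \<times> vec \<times> vec \<Rightarrow> vec \<Rightarrow> bool" where
  "cycle_ok (ws, a, b, c) (x, y, z) \<longleftrightarrow>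
     fst (fold turn_sticker ws ((x, y, z), sides (x, y, z) ! 0)) =
     (if (x, y, z) = a then b else if (x, y, z) = b then c else if (x, y, z) = c then a else (x, y, z))"

text \<open>The word leaves every piece in its position and twists it by \<open>1\<close> at \<open>a\<close>, by \<open>m - 1\<close> at \<open>b\<close> and
  by \<open>0\<close> elsewhere.\<close>

fun twist_ok :: "(vec \<times> int) list \<times> nat \<times> vec \<times> vec \<Rightarrow> vec \<Rightarrow> bool" where
  "twist_ok (ws, m, a, b) (x, y, z) \<longleftrightarrow>
     fold turn_sticker ws ((x, y, z), sides (x, y, z) ! 0) =
     ((x, y, z), sides (x, y, z) ! (if (x, y, z) = a then 1 else if (x, y, z) = b then m - 1 else 0))"

text \<open>The turn sends an element of the list to an element of the list.\<close>

fun meets :: "vec list \<Rightarrow> vec \<times> int \<Rightarrow> bool" where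
  "meets S ((a, b, c), k) \<longleftrightarrow> list_ex (\<lambda>p. turn_at (a, b, c) k p \<in> set S) S"

lemma letters:
  "list_all is_letter corner_word" "list_all is_letter single_edge_word"
  "list_all is_letter coupled_edge_word" "list_all is_letter center_corner_word"
  "list_all is_letter center_edge_word" "list_all is_letter twist_word" "list_all is_letter flip_word"
  by code_simp+

lemma corner_cycle: "list_all (cycle_ok (corner_word, (2,2,2), (2,-2,2), (-2,-2,2))) piece_list"
  by code_simp
lemma single_edge_cycle: "list_all (cycle_ok (single_edge_word, (0,-2,-2), (0,2,-2), (0,2,2))) piece_list"
  by code_simp
lemma coupled_edge_cycle: "list_all (cycle_ok (coupled_edge_word, (-1,2,-2), (2,1,2), (2,1,-2))) piece_list"
  by code_simp
lemma center_corner_cycle: "list_all (cycle_ok (center_corner_word, (-1,-1,2), (1,1,-2), (2,-1,1))) piece_list"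
  by code_simp
lemma center_edge_cycle: "list_all (cycle_ok (center_edge_word, (0,1,-2), (2,1,0), (2,0,1))) piece_list"
  by code_simp
lemma twist_table: "list_all (twist_ok (twist_word, 3, (2,2,2), (2,2,-2))) piece_list"
  by code_simp
lemma flip_table: "list_all (twist_ok (flip_word, 2, (0,-2,-2), (0,2,2))) piece_list"
  by code_simp
lemma meets_tables:
  "list_all (meets [(2,2,2), (2,-2,2), (-2,-2,2)]) turn_list"
  "list_all (meets [(0,-2,-2), (0,2,-2), (0,2,2)]) turn_list"
  "list_all (meets [(-1,2,-2), (2,1,2), (2,1,-2)]) turn_list"
  "list_all (meets [(-1,-1,2), (1,1,-2), (2,-1,1)]) turn_list"
  "list_all (meets [(0,1,-2), (2,1,0), (2,0,1)]) turn_list"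
  "list_all (meets [(2,2,2), (2,2,-2)]) turn_list"
  "list_all (meets [(0,-2,-2), (0,2,2)]) turn_list"
  by code_simp+

fun images :: "vec \<Rightarrow> vec list" where
  "images (x, y, z) = map (\<lambda>(n, k). turn_at n k (x, y, z)) turn_list"

text \<open>The positions reached by \<open>i\<close> quarter turns, where a turn may fix a position.\<close>

fun reach :: "nat \<Rightarrow> vec list \<Rightarrow> vec list" where
  "reach 0 ps = ps"
| "reach (Suc i) ps = reach i (remdups (concat (map images ps)))"

lemma reach_tables:
  "list_all (\<lambda>p. p \<in> set (reach 3 [(2,2,2)])) (kind_list [2,2,2])"
  "list_all (\<lambda>p. p \<in> set (reach 4 [(0,-2,-2)])) (kind_list [0,2,2])"
  "list_all (\<lambda>p. p \<in> set (reach 4 [(-1,2,-2)])) (kind_list [1,2,2])"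
  "list_all (\<lambda>p. p \<in> set (reach 4 [(-1,-1,2)])) (kind_list [1,1,2])"
  "list_all (\<lambda>p. p \<in> set (reach 5 [(0,1,-2)])) (kind_list [0,1,2])"
  by code_simp+

section \<open>Attainable permutations\<close>

text \<open>The permutations of pieces induced by elements of the group; orientations are ignored.\<close>

definition attainable :: "(vec \<Rightarrow> vec) \<Rightarrow> bool" where
  "attainable \<pi> \<longleftrightarrow> layout \<pi> \<and> (\<exists>w. arrange \<pi> w \<in> G5)"

lemma attainable_comp:
  assumes "attainable \<pi>" "attainable \<rho>" shows "attainable (\<pi> \<circ> \<rho>)"
proof -
  obtain v w where *: "layout \<pi>" "layout \<rho>" and G5: "arrange \<pi> v \<in> G5" "arrange \<rho> w \<in> G5"
    using assms by (auto simp: attainable_def)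
  have "arrange (\<pi> \<circ> \<rho>) (\<lambda>q. v q + w (inv \<pi> q)) \<in> G5"
    using comp_in_G5[OF G5] by (simp only: arrange_comp[OF *])
  then show ?thesis using layout_comp[OF *] unfolding attainable_def by blast
qed

lemma attainable_id: "attainable id"
  unfolding attainable_def using arrange_id id_in_G5 layout_id by metis

lemma attainable_inv: assumes "attainable \<pi>" shows "attainable (inv \<pi>)"
proof -
  obtain w where l: "layout \<pi>" and g: "arrange \<pi> w \<in> G5" using assms by (auto simp: attainable_def)
  obtain \<rho> v where \<rho>: "layout \<rho>" "inv (arrange \<pi> w) = arrange \<rho> v"
    using G5_legal[OF inv_in_G5[OF g]] by metis
  have "arrange \<pi> w \<circ> arrange \<rho> v = id"
    using permutes_inv_o(1)[OF G5_permutes[OF g]] \<rho>(2) by simp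
  then have "arrange (\<pi> \<circ> \<rho>) (\<lambda>q. w q + v (inv \<pi> q)) = arrange id (\<lambda>_. 0)"
    by (simp only: arrange_comp[OF l \<rho>(1)] arrange_id)
  then have "\<pi> \<circ> \<rho> = id" using arrange_eqD(1) layout_comp l \<rho>(1) layout_id by blast
  then have "\<rho> = inv \<pi>"
    using l layout_bij by (metis bij_is_inj comp_id inv_o_cancel comp_assoc id_comp)
  then show ?thesis
    unfolding attainable_def using \<rho> inv_in_G5[OF g] by metis
qed

lemma attainable_turn: "n \<in> normals \<Longrightarrow> k \<in> {1, 2} \<Longrightarrow> attainable (turn_pos n k)"
  unfolding attainable_def
  using layout_turn_pos quarter_turn_eq_arrange quarter_turn_in_G5 by metis

definition turn_maps :: "(vec \<Rightarrow> vec) set" where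
  "turn_maps = {turn_pos n k | n k. n \<in> normals \<and> k \<in> {1, 2}}"

lemma reach_subset:
  assumes "\<And>\<gamma> p. \<gamma> \<in> turn_maps \<Longrightarrow> p \<in> K \<Longrightarrow> \<gamma> p \<in> K" "set ps \<subseteq> K" "set ps \<subseteq> pieces"
  shows "set (reach i ps) \<subseteq> K"
  using assms(2,3)
proof (induction i arbitrary: ps)
  case (Suc i)
  have "q \<in> K \<and> q \<in> pieces" if ps: "p \<in> set ps" and q: "q \<in> set (images p)" for p q
  proof -
    have "set (images p) = (\<lambda>(n, k). turn_at n k p) ` set turn_list" by (cases p) simp
    then obtain x where x: "x \<in> set turn_list" "q = (\<lambda>(n, k). turn_at n k p) x"
      using q by blast
    obtain n k where "x = (n, k)" by (cases x)
    then have nk: "n \<in> normals" "k \<in> {1, 2}" "q = turn_at n k p"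
      using x set_turn_list by auto
    have p: "p \<in> pieces" "p \<in> K" using ps Suc.prems by auto
    have "q = turn_pos n k p" using nk p by (simp add: turn_pos_def)
    then show ?thesis
      using nk p assms(1)[of "turn_pos n k" p] layout_turn_pos layout_pieces by (auto simp: turn_maps_def)
  qed
  then have "set (remdups (concat (map images ps))) \<subseteq> K" "set (remdups (concat (map images ps))) \<subseteq> pieces"
    unfolding set_remdups set_concat set_map by blast+
  then show ?case unfolding reach.simps by (rule Suc.IH)
qed simp

text \<open>The attainable permutations of one kind of pieces are normalized by the quarter turns, so a word
  that acts as a three-cycle yields all even permutations.\<close>

lemma even_perm_attainable_by_word:
  assumes T: "T \<in> kinds" "T = set (kind_list l)" and "l \<in> set shapes"
    and ws: "list_all is_letter ws" "list_all (cycle_ok (ws, a, b, c)) piece_list"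
    and d: "distinct [a, b, c]" and in_T: "list_all (\<lambda>p. abs_coords p = l) [a, b, c]"
    and meets: "list_all (meets [a, b, c]) turn_list"
    and reach: "list_all (\<lambda>p. p \<in> set (reach i [a])) (kind_list l)"
    and \<pi>: "\<pi> permutes T" "evenperm \<pi>"
  shows "attainable \<pi>"
proof -
  define E where "E = {\<pi>. \<pi> permutes T \<and> attainable \<pi>}"
  interpret permutation_subgroup T E
    by unfold_locales
      (auto simp: E_def finite_kind[OF T(1)] permutes_id permutes_compose permutes_inv attainable_id
        attainable_comp attainable_inv)
  have abc: "a \<in> T" "b \<in> T" "c \<in> T" "a \<in> pieces"
    using in_T assms(3) pieces_subset_cube by (auto simp: T(2) kind_list_def pieces_iff)
  have "cyc3 a b c \<in> E"
  proof -
    obtain g where g: "g \<in> G5" "\<And>s. s \<in> stickers \<Longrightarrow> g s = fold turn_sticker ws s"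
      using word_in_G5[OF ws(1)] by blast
    obtain \<rho> w where \<rho>: "layout \<rho>" "g = arrange \<rho> w" using G5_legal[OF g(1)] by metis
    have "\<rho> p = cyc3 a b c p" if p: "p \<in> pieces" for p
    proof -
      have l: "0 < length (sides p)" using length_sides_pieces[OF p] by auto
      then have "(p, sides p ! 0) \<in> stickers"
        using p pieces_subset_cube by (auto simp: stickers_iff)
      then have "\<rho> p = fst (fold turn_sticker ws (p, sides p ! 0))"
        using g(2) arrange_nth[OF \<rho>(1) p l] \<rho>(2) by (metis fst_conv)
      also have "\<dots> = cyc3 a b c p"
        using ws(2) p set_piece_list d by (cases p) (auto simp: list_all_iff cyc3_apply)
      finally show ?thesis .
    qed
    moreover have "\<rho> p = cyc3 a b c p" if "p \<notin> pieces" for p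
    proof -
      have "cyc3 a b c permutes pieces"
        using cyc3_permutes[OF abc(1-3)] kind_subset_pieces[OF T(1)] by (rule permutes_subset)
      then show ?thesis using that \<rho>(1) unfolding layout_def by (metis permutes_not_in)
    qed
    ultimately have "\<rho> = cyc3 a b c" by blast
    then show ?thesis
      using \<rho> g(1) cyc3_permutes[OF abc(1-3)] unfolding E_def attainable_def by blast
  qed
  have turn_map: "layout \<gamma> \<and> attainable \<gamma>" if "\<gamma> \<in> turn_maps" for \<gamma>
    using that by (auto simp: turn_maps_def layout_turn_pos attainable_turn)
  have "\<pi> \<in> E"
  proof (rule even_perm_in[where \<Gamma> = turn_maps and a = a and b = b and c = c])
    fix \<gamma> \<rho> assume \<gamma>: "\<gamma> \<in> turn_maps" and \<rho>: "\<rho> \<in> E"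
    have l: "layout \<gamma>" using turn_map \<gamma> by blast
    have "bij (\<gamma> \<circ> \<rho> \<circ> inv \<gamma>)"
      using l layout_bij \<rho> by (auto simp: E_def bij_imp_bij_inv intro!: bij_comp dest: permutes_bij)
    moreover have "(\<gamma> \<circ> \<rho> \<circ> inv \<gamma>) p = p" if "p \<notin> T" for p
    proof -
      have "inv \<gamma> p \<notin> T" using that layout_kind[OF layout_inv[OF l] T(1)] by simp
      then show ?thesis
        using \<rho> l layout_bij[OF l] by (auto simp: E_def permutes_not_in bij_is_surj surj_f_inv_f)
    qed
    ultimately have "\<gamma> \<circ> \<rho> \<circ> inv \<gamma> permutes T" unfolding permutes_def bij_iff by blast
    then show "\<gamma> \<circ> \<rho> \<circ> inv \<gamma> \<in> E"
      using \<gamma> \<rho> turn_map attainable_comp attainable_inv by (auto simp: E_def)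
  next
    fix \<gamma> assume "\<gamma> \<in> turn_maps" then show "bij \<gamma>" using turn_map layout_bij by blast
  next
    fix K assume "a \<in> K" "\<And>\<gamma> p. \<gamma> \<in> turn_maps \<Longrightarrow> p \<in> K \<Longrightarrow> \<gamma> p \<in> K"
    then have "set (reach i [a]) \<subseteq> K" using abc by (intro reach_subset) auto
    then show "T \<subseteq> K" using reach by (auto simp: T(2) list_all_iff)
  next
    fix \<gamma> assume "\<gamma> \<in> turn_maps"
    then obtain n k where nk: "n \<in> normals" "k \<in> {1, 2}" "\<gamma> = turn_pos n k" by (auto simp: turn_maps_def)
    then have "meets [a, b, c] (n, k)" using meets by (auto simp: list_all_iff set_turn_list)
    then have "\<exists>p\<in>{a, b, c}. turn_at n k p \<in> {a, b, c}" by (cases n) auto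
    moreover have "turn_at n k p = \<gamma> p" if "p \<in> {a, b, c}" for p
      using that abc kind_subset_pieces[OF T(1)] nk(3) by (auto simp: turn_pos_def)
    ultimately show "\<exists>p\<in>{a, b, c}. \<gamma> p \<in> {a, b, c}" by metis
  qed (use d \<open>cyc3 a b c \<in> E\<close> \<pi> in auto)
  then show ?thesis by (simp add: E_def)
qed

lemma even_perm_attainable:
  assumes "T \<in> kinds" "\<pi> permutes T" "evenperm \<pi>"
  shows "attainable \<pi>"
proof -
  consider "T = corners" | "T = single_edges" | "T = coupled_edges" | "T = center_corners" | "T = center_edges"
    using assms(1) by (auto simp: kinds_def)
  then show ?thesis
  proof cases
    case 1
    show ?thesis
      by (rule even_perm_attainable_by_word[OF assms(1) _ _ letters(1) corner_cycle _ _ meets_tables(1) reach_tables(1)])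
        (use assms in \<open>simp_all add: 1 kind_lists shapes_def abs_coords.simps\<close>)
  next
    case 2
    show ?thesis
      by (rule even_perm_attainable_by_word[OF assms(1) _ _ letters(2) single_edge_cycle _ _ meets_tables(2) reach_tables(2)])
        (use assms in \<open>simp_all add: 2 kind_lists shapes_def abs_coords.simps\<close>)
  next
    case 3
    show ?thesis
      by (rule even_perm_attainable_by_word[OF assms(1) _ _ letters(3) coupled_edge_cycle _ _ meets_tables(3) reach_tables(3)])
        (use assms in \<open>simp_all add: 3 kind_lists shapes_def abs_coords.simps\<close>)
  next
    case 4
    show ?thesis
      by (rule even_perm_attainable_by_word[OF assms(1) _ _ letters(4) center_corner_cycle _ _ meets_tables(4) reach_tables(4)])
        (use assms in \<open>simp_all add: 4 kind_lists shapes_def abs_coords.simps\<close>)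
  next
    case 5
    show ?thesis
      by (rule even_perm_attainable_by_word[OF assms(1) _ _ letters(5) center_edge_cycle _ _ meets_tables(5) reach_tables(5)])
        (use assms in \<open>simp_all add: 5 kind_lists shapes_def abs_coords.simps\<close>)
  qed
qed

section \<open>Pure twists\<close>

text \<open>The orientations attained without moving a piece.\<close>

definition twist :: "(vec \<Rightarrow> nat) \<Rightarrow> bool" where
  "twist w \<longleftrightarrow> arrange id w \<in> G5"

lemma twist_zero: "twist (\<lambda>_. 0)"
  by (simp only: twist_def arrange_id id_in_G5)

lemma twist_add: "twist v \<Longrightarrow> twist w \<Longrightarrow> twist (\<lambda>q. v q + w q)"
  using comp_in_G5[of "arrange id v" "arrange id w"]
  by (simp add: twist_def arrange_comp[OF layout_id layout_id] del: id_apply) (simp add: inv_id)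

lemma twist_cong:
  assumes "twist v" "\<And>q. q \<in> pieces \<Longrightarrow> [v q = w q] (mod length (sides q))"
  shows "twist w"
  using assms arrange_cong[OF layout_id assms(2)] by (simp add: twist_def)

lemma twist_mult: "twist w \<Longrightarrow> twist (\<lambda>q. k * w q)"
  by (induction k) (auto simp: twist_zero intro: twist_add)

lemma twist_sum: "finite I \<Longrightarrow> (\<And>i. i \<in> I \<Longrightarrow> twist (f i)) \<Longrightarrow> twist (\<lambda>q. \<Sum>i\<in>I. f i q)"
  by (induction I rule: finite_induct) (auto simp: twist_zero intro: twist_add)

text \<open>Conjugation moves a twist along with the pieces; orientations cancel, since twists commute.\<close>

lemma twist_conj:
  assumes "attainable \<gamma>" "twist w"
  shows "twist (\<lambda>q. w (inv \<gamma> q))"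
proof -
  obtain v where l: "layout \<gamma>" and g: "arrange \<gamma> v \<in> G5" using assms(1) by (auto simp: attainable_def)
  define g where "g = arrange \<gamma> v"
  have gp: "g permutes stickers" "g \<in> G5" using g G5_permutes by (auto simp: g_def)
  have "g \<circ> arrange id w = arrange id (\<lambda>q. w (inv \<gamma> q)) \<circ> g"
    unfolding g_def arrange_comp[OF l layout_id] arrange_comp[OF layout_id l]
    by (simp add: inv_id add.commute)
  then have "g \<circ> arrange id w \<circ> inv g = arrange id (\<lambda>q. w (inv \<gamma> q))"
    using permutes_inv_o(1)[OF gp(1)] by (simp add: comp_assoc)
  then show ?thesis
    using comp_in_G5[OF comp_in_G5[OF gp(2)] inv_in_G5[OF gp(2)]] assms(2) by (metis twist_def)
qed

text \<open>Being the ends of an attainable \<^const>\<open>pair_twist\<close> is an equivalence relation on the pieces of one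
  kind that is invariant under quarter turns. One word that relates two pieces thus relates all.\<close>

lemma pair_twist_by_word:
  assumes T: "T \<in> kinds" "T = set (kind_list l)" "l \<in> set shapes" and m: "\<And>q. q \<in> T \<Longrightarrow> length (sides q) = m" "2 \<le> m"
    and ws: "list_all is_letter ws" "list_all (twist_ok (ws, m, a, b)) piece_list"
    and ab: "a \<noteq> b" "abs_coords a = l" "abs_coords b = l"
    and meets: "list_all (meets [a, b]) turn_list"
    and reach: "list_all (\<lambda>p. p \<in> set (reach i [a])) (kind_list l)"
    and "p \<in> T" "q \<in> T"
  shows "twist (pair_twist m p q)"
proof -
  have in_T: "a \<in> T" "b \<in> T"
    using ab T pieces_subset_cube by (auto simp: T(2) kind_list_def pieces_iff)
  have "T \<subseteq> pieces" using kind_subset_pieces T(1) by blast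
  define R where "R = (\<lambda>p q. p \<in> T \<and> q \<in> T \<and> twist (pair_twist m p q))"
  have R_trans: "R p r" if "R p q" "R q r" for p q r
  proof -
    have "twist (\<lambda>x. pair_twist m p q x + pair_twist m q r x)"
      using that by (auto simp: R_def intro: twist_add)
    then have "twist (pair_twist m p r)"
    proof (rule twist_cong)
      fix x assume "x \<in> pieces"
      show "[pair_twist m p q x + pair_twist m q r x = pair_twist m p r x] (mod length (sides x))"
      proof (cases "x = q")
        case True
        then have "length (sides x) = m" using that m(1) by (auto simp: R_def)
        moreover have "pair_twist m p q x + pair_twist m q r x = pair_twist m p r x + m"
          using True m(2) by (simp add: pair_twist_def)
        ultimately show ?thesis by (simp add: cong_def)
      qed (simp add: pair_twist_def)
    qed
    then show ?thesis using that by (auto simp: R_def)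
  qed
  have R_sym: "R q p" if "R p q" for p q
  proof -
    have "twist (\<lambda>x. (m - 1) * pair_twist m p q x)" using that by (auto simp: R_def intro: twist_mult)
    then have "twist (pair_twist m q p)"
    proof (rule twist_cong)
      fix x assume "x \<in> pieces"
      have sq: "[(m - 1) * (m - 1) = 1] (mod m)"
      proof -
        obtain j where "m = Suc (Suc j)" using le_Suc_ex[OF m(2)] by auto
        then have "(m - 1) * (m - 1) = 1 + j * m" by (simp add: algebra_simps)
        then show ?thesis by (simp only: cong_def mod_mult_self1)
      qed
      have "[(m - 1) * of_bool (x = p) + (m - 1) * (m - 1) * of_bool (x = q) =
          (m - 1) * of_bool (x = p) + 1 * of_bool (x = q)] (mod m)"
        by (intro cong_add cong_mult cong_refl sq)
      then have "[(m - 1) * pair_twist m p q x = pair_twist m q p x] (mod m)"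
        by (simp only: pair_twist_def distrib_left mult.assoc mult_1 add.commute)
      moreover have "pair_twist m p q x = 0" "pair_twist m q p x = 0" if "x \<notin> T"
        using that \<open>R p q\<close> by (auto simp: pair_twist_def R_def)
      ultimately show "[(m - 1) * pair_twist m p q x = pair_twist m q p x] (mod length (sides x))"
        using m(1) by (cases "x \<in> T") auto
    qed
    then show ?thesis using that by (auto simp: R_def)
  qed
  have R_self: "R p p" if "p \<in> T" for p
  proof -
    have "twist (pair_twist m p p)"
    proof (rule twist_cong[OF twist_zero])
      fix x assume "x \<in> pieces"
      show "[0 = pair_twist m p p x] (mod length (sides x))"
        using m that by (cases "x = p") (auto simp: pair_twist_def cong_def)
    qed
    then show ?thesis using that by (simp add: R_def)
  qed
  have "R a b"
  proof -
    obtain g where g: "g \<in> G5" "\<And>s. s \<in> stickers \<Longrightarrow> g s = fold turn_sticker ws s"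
      using word_in_G5[OF ws(1)] by blast
    obtain \<rho> w where \<rho>: "layout \<rho>" "g = arrange \<rho> w" using G5_legal[OF g(1)] by metis
    have main: "\<rho> p = p \<and> [w p = pair_twist m a b p] (mod length (sides p))" if p: "p \<in> pieces" for p
    proof -
      have l: "0 < length (sides p)" using length_sides_pieces[OF p] by auto
      then have "(p, sides p ! 0) \<in> stickers"
        using p pieces_subset_cube by (auto simp: stickers_iff)
      then have "arrange \<rho> w (p, sides p ! 0) = fold turn_sticker ws (p, sides p ! 0)"
        using g(2) \<rho>(2) by blast
      also have "\<dots> = (p, sides p ! (if p = a then 1 else if p = b then m - 1 else 0))"
      proof -
        have "twist_ok (ws, m, a, b) p" using ws(2) p set_piece_list by (auto simp: list_all_iff)
        then show ?thesis by (cases p) (simp only: twist_ok.simps)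
      qed
      also have "(if p = a then 1 else if p = b then m - 1 else 0) = pair_twist m a b p"
        using ab(1) by (simp add: pair_twist_def)
      finally have *: "\<rho> p = p" "sides p ! (w p mod length (sides p)) = sides p ! pair_twist m a b p"
        using arrange_nth[OF \<rho>(1) p l, of w] by auto
      have "pair_twist m a b p < length (sides p)"
        using l m in_T ab(1) by (auto simp: pair_twist_def)
      then show ?thesis
        using * l by (simp add: nth_eq_iff_index_eq distinct_sides cong_def)
    qed
    then have "\<rho> = id"
      using \<rho>(1) by (auto simp: fun_eq_iff layout_def permutes_def)
    then have "twist w" using \<rho> g(1) by (simp add: twist_def)
    then have "twist (pair_twist m a b)" by (rule twist_cong) (use main in blast)
    then show ?thesis using in_T by (simp add: R_def)
  qed
  have turn_map: "layout \<gamma> \<and> attainable \<gamma>" if "\<gamma> \<in> turn_maps" for \<gamma>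
    using that by (auto simp: turn_maps_def layout_turn_pos attainable_turn)
  have block: "R a q" if "q \<in> T" for q
  proof (rule block_is_everything[where S = "{a, b}" and \<Gamma> = turn_maps and R = R and X = T])
    fix \<gamma> p q assume \<gamma>: "\<gamma> \<in> turn_maps" and pq: "R p q"
    have l: "layout \<gamma>" using turn_map \<gamma> by blast
    have "inv \<gamma> x = r \<longleftrightarrow> x = \<gamma> r" for x r
      using bij_inv_eq_iff[OF layout_bij[OF l]] by metis
    then have "(\<lambda>x. pair_twist m p q (inv \<gamma> x)) = pair_twist m (\<gamma> p) (\<gamma> q)"
      unfolding pair_twist_def by presburger
    then show "R (\<gamma> p) (\<gamma> q)"
      using twist_conj[of \<gamma> "pair_twist m p q"] turn_map[OF \<gamma>] pq layout_kind[OF l T(1)] by (auto simp: R_def)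
  next
    fix K assume K: "a \<in> K" and closed: "\<And>\<gamma> p. \<gamma> \<in> turn_maps \<Longrightarrow> p \<in> K \<Longrightarrow> \<gamma> p \<in> K"
    then have "set (reach i [a]) \<subseteq> K" using in_T \<open>T \<subseteq> pieces\<close> by (intro reach_subset) auto
    then show "T \<subseteq> K" using reach by (auto simp: T(2) list_all_iff)
  next
    fix \<gamma> assume "\<gamma> \<in> turn_maps"
    then obtain n k where nk: "n \<in> normals" "k \<in> {1, 2}" "\<gamma> = turn_pos n k" by (auto simp: turn_maps_def)
    then have "meets [a, b] (n, k)" using meets by (auto simp: list_all_iff set_turn_list)
    then have "\<exists>p\<in>{a, b}. turn_at n k p \<in> {a, b}" by (cases n) auto
    moreover have "turn_at n k p = \<gamma> p" if "p \<in> {a, b}" for p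
      using that in_T \<open>T \<subseteq> pieces\<close> nk(3) by (auto simp: turn_pos_def)
    ultimately show "\<exists>p\<in>{a, b}. \<gamma> p \<in> {a, b}" by metis
  next
    fix p assume "p \<in> {a, b}"
    then show "R a p" using R_self[OF in_T(1)] \<open>R a b\<close> by auto
  qed (fact R_trans, fact R_sym, simp, fact that)
  have "R p q" using R_trans[OF R_sym[OF block[OF \<open>p \<in> T\<close>]] block[OF \<open>q \<in> T\<close>]] .
  then show ?thesis by (simp add: R_def)
qed

lemma corner_pair_twist: "p \<in> corners \<Longrightarrow> q \<in> corners \<Longrightarrow> twist (pair_twist 3 p q)"
  by (rule pair_twist_by_word[OF kindsI(1) kind_lists(1) _ _ _ letters(6) twist_table _ _ _
        meets_tables(6) reach_tables(1)])
    (simp_all add: shapes_def abs_coords.simps length_sides_kind)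

lemma single_edge_pair_twist: "p \<in> single_edges \<Longrightarrow> q \<in> single_edges \<Longrightarrow> twist (pair_twist 2 p q)"
  by (rule pair_twist_by_word[OF kindsI(2) kind_lists(2) _ _ _ letters(7) flip_table _ _ _
        meets_tables(7) reach_tables(2)])
    (simp_all add: shapes_def abs_coords.simps length_sides_kind)

text \<open>The total twist of the pieces of a kind is the only obstruction: the twists of all pieces can be
  pushed, one at a time, to a fixed piece \<open>a\<close>.\<close>

lemma twist_on_kind:
  assumes T: "T \<in> kinds" and m: "\<And>q. q \<in> T \<Longrightarrow> length (sides q) = m" "2 \<le> m"
    and pairs: "\<And>p q. p \<in> T \<Longrightarrow> q \<in> T \<Longrightarrow> twist (pair_twist m p q)"
    and sum: "[(\<Sum>q\<in>T. w q) = 0] (mod m)"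
  shows "twist (\<lambda>q. if q \<in> T then w q else 0)"
proof (cases "T = {}")
  case True
  then show ?thesis by (simp add: twist_zero)
next
  case False
  then obtain a where a: "a \<in> T" by blast
  have fin: "finite T" using T finite_kind by blast
  have "twist (\<lambda>r. \<Sum>p\<in>T. w p * pair_twist m p a r)"
    using fin pairs a by (intro twist_sum twist_mult) auto
  then show ?thesis
  proof (rule twist_cong)
    fix r assume "r \<in> pieces"
    have "(\<Sum>p\<in>T. w p * pair_twist m p a r) =
        (\<Sum>p\<in>T. w p * of_bool (r = p)) + (\<Sum>p\<in>T. w p) * ((m - 1) * of_bool (r = a))"
      by (simp only: pair_twist_def distrib_left sum.distrib sum_distrib_right)
    also have "(\<Sum>p\<in>T. w p * of_bool (r = p)) = (if r \<in> T then w r else 0)"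
      using fin by (simp add: of_bool_def if_distrib[where f = "\<lambda>x. _ * x"] cong: if_cong)
    finally have eq: "(\<Sum>p\<in>T. w p * pair_twist m p a r) =
        (if r \<in> T then w r else 0) + (\<Sum>p\<in>T. w p) * ((m - 1) * of_bool (r = a))" .
    show "[(\<Sum>p\<in>T. w p * pair_twist m p a r) = (if r \<in> T then w r else 0)] (mod length (sides r))"
    proof (cases "r = a")
      case True
      have "[(\<Sum>p\<in>T. w p) * ((m - 1) * of_bool (r = a)) = 0 * ((m - 1) * of_bool (r = a))] (mod m)"
        by (intro cong_mult sum cong_refl)
      then have "[(if r \<in> T then w r else 0) + (\<Sum>p\<in>T. w p) * ((m - 1) * of_bool (r = a)) =
          (if r \<in> T then w r else 0) + 0] (mod m)"
        by (intro cong_add cong_refl) simp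
      then show ?thesis using m(1)[OF a] True unfolding eq by simp
    qed (simp add: eq)
  qed
qed

lemma legal_twist:
  assumes "[(\<Sum>q\<in>corners. w q) = 0] (mod 3)" "[(\<Sum>q\<in>single_edges. w q) = 0] (mod 2)"
    and "\<And>q. q \<in> coupled_edges \<Longrightarrow> [w q = 0] (mod 2)"
  shows "twist w"
proof -
  have "twist (\<lambda>q. if q \<in> corners then w q else 0)"
    by (rule twist_on_kind[where m = 3]) (use assms(1) corner_pair_twist length_sides_kind in auto)
  moreover have "twist (\<lambda>q. if q \<in> single_edges then w q else 0)"
    by (rule twist_on_kind[where m = 2]) (use assms(2) single_edge_pair_twist length_sides_kind in auto)
  ultimately have "twist (\<lambda>q. (if q \<in> corners then w q else 0) + (if q \<in> single_edges then w q else 0))"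
    by (rule twist_add)
  then show ?thesis
  proof (rule twist_cong)
    fix q assume "q \<in> pieces"
    then consider "q \<in> corners" | "q \<in> single_edges" | "q \<in> coupled_edges" | "length (sides q) = 1"
      using length_sides_kind(4,5)[of q] by (auto simp: pieces_def)
    then show "[(if q \<in> corners then w q else 0) + (if q \<in> single_edges then w q else 0) = w q]
        (mod length (sides q))"
    proof cases
      case 3
      then have "[0 = w q] (mod 2)" using assms(3) cong_sym by blast
      then show ?thesis using 3 length_sides_kind(3)[OF 3] by (auto simp: kind_defs)
    qed (auto simp: kind_defs)
  qed
qed

section \<open>Sufficiency of the conditions\<close>

lemma layout_attainable:
  assumes l: "layout \<pi>" and even: "\<And>T. T \<in> kinds \<Longrightarrow> sgn_on T \<pi> = 1"
  shows "attainable \<pi>"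
proof -
  have part: "attainable (perm_restrict \<pi> T)" if T: "T \<in> kinds" for T
  proof (rule even_perm_attainable[OF T perm_restrict_permutes[OF l T]])
    show "evenperm (perm_restrict \<pi> T)"
      using even[OF T] by (simp add: sign_def split: if_splits)
  qed
  have "\<pi> p = (perm_restrict \<pi> corners \<circ> perm_restrict \<pi> single_edges \<circ>
      perm_restrict \<pi> coupled_edges \<circ> perm_restrict \<pi> center_corners \<circ> perm_restrict \<pi> center_edges) p"
    for p
  proof -
    have "abs_coords (\<pi> p) = abs_coords p" "p \<notin> pieces \<Longrightarrow> \<pi> p = p"
      using l by (auto simp: layout_def permutes_not_in)
    then show ?thesis by (auto simp: perm_restrict_def kind_defs pieces_def)
  qed
  then have "\<pi> = perm_restrict \<pi> corners \<circ> perm_restrict \<pi> single_edges \<circ>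
      perm_restrict \<pi> coupled_edges \<circ> perm_restrict \<pi> center_corners \<circ> perm_restrict \<pi> center_edges"
    by blast
  moreover have "attainable (perm_restrict \<pi> corners \<circ> perm_restrict \<pi> single_edges \<circ>
      perm_restrict \<pi> coupled_edges \<circ> perm_restrict \<pi> center_corners \<circ> perm_restrict \<pi> center_edges)"
    by (intro attainable_comp part kindsI)
  ultimately show ?thesis by simp
qed

text \<open>If the permutation is even on every kind, some element of the group has the same permutation, and
  by necessity its orientations satisfy the conditions too. What remains is a pure twist.\<close>

lemma legal_even_in_G5:
  assumes l: "layout \<pi>" and legal: "legal \<pi> w" and even: "\<And>T. T \<in> kinds \<Longrightarrow> sgn_on T \<pi> = 1"
  shows "arrange \<pi> w \<in> G5"
proof -
  obtain v' where g: "arrange \<pi> v' \<in> G5"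
    using layout_attainable[OF l even] by (auto simp: attainable_def)
  obtain \<rho> v where \<rho>: "layout \<rho>" "legal \<rho> v" "arrange \<pi> v' = arrange \<rho> v"
    using G5_legal[OF g] by metis
  have "\<rho> = \<pi>" using arrange_eqD(1)[OF l \<rho>(1,3)] by simp
  then have v: "legal \<pi> v" "arrange \<pi> v \<in> G5" using \<rho> g by auto
  \<comment> \<open>Since \<open>6\<close> is a multiple of the number of sides of every piece, \<open>5\<close> acts as \<open>-1\<close>.\<close>
  define u where "u = (\<lambda>q. w q + 5 * v q)"
  have "twist u"
  proof (rule legal_twist)
    have "[(\<Sum>q\<in>corners. w q) + 5 * (\<Sum>q\<in>corners. v q) = 0 + 5 * 0] (mod 3)"
      using legal v(1) by (intro cong_add cong_mult cong_refl) (auto simp: legal_def)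
    then show "[(\<Sum>q\<in>corners. u q) = 0] (mod 3)"
      by (simp add: u_def sum.distrib sum_distrib_left)
    have "[(\<Sum>q\<in>single_edges. w q) + 5 * (\<Sum>q\<in>single_edges. v q) = 0 + 5 * 0] (mod 2)"
      using legal v(1) by (intro cong_add cong_mult cong_refl) (auto simp: legal_def)
    then show "[(\<Sum>q\<in>single_edges. u q) = 0] (mod 2)"
      by (simp add: u_def sum.distrib sum_distrib_left)
    fix q assume q: "q \<in> coupled_edges"
    define p where "p = inv \<pi> q"
    have p: "q = \<pi> p" using layout_bij[OF l] by (simp add: p_def bij_is_surj surj_f_inv_f)
    have "p \<in> coupled_edges" using q l layout_kind p by auto
    then have "[w q = b_type p + b_type q] (mod 2)" "[v q = b_type p + b_type q] (mod 2)"
      using legal v(1) p by (auto simp: legal_def)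
    then show "[u q = 0] (mod 2)" unfolding u_def cong_def by presburger
  qed
  then have "arrange id u \<circ> arrange \<pi> v \<in> G5" using v(2) comp_in_G5 by (simp add: twist_def)
  also have "arrange id u \<circ> arrange \<pi> v = arrange \<pi> (\<lambda>q. u q + v q)"
    unfolding arrange_comp[OF layout_id l] by (simp add: inv_id)
  also have "\<dots> = arrange \<pi> w"
  proof (rule arrange_cong[OF l])
    fix q assume "q \<in> pieces"
    then have "length (sides q) dvd 6" using length_sides_pieces by fastforce
    then have "[6 * v q = 0] (mod length (sides q))" by (simp add: cong_0_iff)
    then have "[w q + 6 * v q = w q + 0] (mod length (sides q))" by (intro cong_add cong_refl)
    then show "[u q + v q = w q] (mod length (sides q))" by (simp add: u_def algebra_simps)
  qed
  finally show ?thesis .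
qed

lemma sgn_on_cases: "sgn_on T \<pi> = 1 \<or> sgn_on T \<pi> = -1"
  by (simp add: sign_def)

text \<open>Membership in the group may be shown after one more quarter turn.\<close>

lemma turn_reduction:
  assumes nk: "n \<in> normals" "k \<in> {1, 2}" and l: "layout \<pi>" "legal \<pi> w"
    and reduced: "\<And>v. layout (turn_pos n k \<circ> \<pi>) \<Longrightarrow> legal (turn_pos n k \<circ> \<pi>) v \<Longrightarrow>
      arrange (turn_pos n k \<circ> \<pi>) v \<in> G5"
  shows "arrange \<pi> w \<in> G5"
proof -
  note lq = layout_turn_pos[OF nk(1), of k]
  define q where "q = quarter_turn n k"
  have q: "q \<in> G5" "q = arrange (turn_pos n k) (turn_ori n k)"
    using nk quarter_turn_in_G5 quarter_turn_eq_arrange by (auto simp: q_def)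
  have "q \<circ> arrange \<pi> w \<in> G5"
    unfolding q(2) arrange_comp[OF lq l(1)]
    by (intro reduced layout_comp legal_comp lq l legal_turn nk)
  then have "inv q \<circ> (q \<circ> arrange \<pi> w) \<in> G5" by (rule comp_in_G5[OF inv_in_G5[OF q(1)]])
  also have "inv q \<circ> (q \<circ> arrange \<pi> w) = arrange \<pi> w"
    using permutes_inv_o(2)[OF G5_permutes[OF q(1)]] by (simp add: o_assoc)
  finally show ?thesis .
qed

text \<open>A turn of an outer slice makes the permutation of the corners even, and then a turn of an inner
  slice that of the center edges; the conditions on signs make the other permutations even as
  well.\<close>

theorem legal_in_G5:
  assumes "layout \<pi>" "legal \<pi> w"
  shows "arrange \<pi> w \<in> G5"
proof -
  have R: "(1, 0, 0) \<in> normals" by (simp add: normals_def)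
  have all_even: "arrange \<pi> w \<in> G5"
    if "layout \<pi>" "legal \<pi> w" "sgn_on corners \<pi> = 1" "sgn_on center_edges \<pi> = 1" for \<pi> w
    using that(3,4) by (intro legal_even_in_G5 that(1,2)) (use that(2) in \<open>auto simp: kinds_def legal_def\<close>)
  have corners_even: "arrange \<pi> w \<in> G5"
    if *: "layout \<pi>" "legal \<pi> w" "sgn_on corners \<pi> = 1" for \<pi> w
  proof (cases "sgn_on center_edges \<pi> = 1")
    case False
    then have c: "sgn_on center_edges \<pi> = -1" using sgn_on_cases by blast
    show ?thesis
      by (rule turn_reduction[OF R _ *(1,2), of 1], simp, rule all_even)
        (simp_all add: sgn_on_comp layout_turn_pos[OF R] *(1,3) c turn_signs[OF R])
  qed (use all_even * in blast)
  show ?thesis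
  proof (cases "sgn_on corners \<pi> = 1")
    case False
    then have c: "sgn_on corners \<pi> = -1" using sgn_on_cases by blast
    show ?thesis
      by (rule turn_reduction[OF R _ assms, of 2], simp, rule corners_even)
        (simp_all add: sgn_on_comp layout_turn_pos[OF R] assms(1) c turn_signs[OF R])
  qed (use corners_even assms in blast)
qed

lemma legal_cong:
  assumes l: "layout \<pi>" and "legal \<pi> v" and c: "\<And>q. q \<in> pieces \<Longrightarrow> [v q = w q] (mod length (sides q))"
  shows "legal \<pi> w"
proof -
  have "[(\<Sum>q\<in>corners. w q) = (\<Sum>q\<in>corners. v q)] (mod 3)"
    using c length_sides_kind(1) by (intro cong_sum) (metis UnI1 cong_sym pieces_def)
  moreover have "[(\<Sum>q\<in>single_edges. w q) = (\<Sum>q\<in>single_edges. v q)] (mod 2)"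
    using c length_sides_kind(2) by (intro cong_sum) (metis UnI1 UnI2 cong_sym pieces_def)
  moreover have "[w (\<pi> p) = v (\<pi> p)] (mod 2)" if "p \<in> coupled_edges" for p
    using c[of "\<pi> p"] length_sides_kind(3)[of "\<pi> p"] layout_kind[OF l, of coupled_edges p] that
    by (auto simp: pieces_def cong_sym)
  ultimately show ?thesis
    using assms(2) unfolding legal_def by (meson cong_trans)
qed

theorem arrange_in_G5_iff:
  assumes "layout \<pi>"
  shows "arrange \<pi> w \<in> G5 \<longleftrightarrow> legal \<pi> w"
proof
  assume g: "arrange \<pi> w \<in> G5"
  obtain \<rho> v where \<rho>: "layout \<rho>" "legal \<rho> v" "arrange \<pi> w = arrange \<rho> v"
    using G5_legal[OF g] by metis
  have "[v q = w q] (mod length (sides q))" if "q \<in> pieces" for q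
    using arrange_eqD(2)[OF assms \<rho>(1,3) that] by (rule cong_sym)
  moreover have "legal \<pi> v" using arrange_eqD(1)[OF assms \<rho>(1,3)] \<rho>(2) by simp
  ultimately show "legal \<pi> w" using legal_cong[OF assms, of v w] by blast
qed (use legal_in_G5 assms in blast)

section \<open>Configurations\<close>

lemma coupled_pos_table:
  "list_all (\<lambda>i. midpoint (coupled_pos i A) = i \<and> midpoint (coupled_pos i B) = i \<and>
     abs_coords (coupled_pos i A) = [1,2,2] \<and> abs_coords (coupled_pos i B) = [1,2,2] \<and>
     coupled_pos i A \<noteq> coupled_pos i B) (kind_list [0,2,2])"
  "list_all (\<lambda>p. abs_coords (midpoint p) = [0,2,2] \<and>
     (p = coupled_pos (midpoint p) A \<or> p = coupled_pos (midpoint p) B)) (kind_list [1,2,2])"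
  by code_simp+

lemma coupled_pos:
  assumes "i \<in> single_edges"
  shows "midpoint (coupled_pos i t) = i" "coupled_pos i t \<in> coupled_edges"
    "b_type (coupled_pos i t) = of_bool (t = B)"
  using coupled_pos_table(1) assms unfolding kind_lists(2)
  by (cases t; force simp: list_all_iff coupled_edges_def b_type_def)+

lemma coupled_posE:
  assumes "p \<in> coupled_edges"
  obtains i t where "i \<in> single_edges" "p = coupled_pos i t"
  using coupled_pos_table(2) assms unfolding kind_lists(3) list_all_iff single_edges_def by blast

text \<open>The condition on the orientations of coupled edges, in terms of types of positions as bits.\<close>

lemma occupant_condition:
  assumes \<tau>: "\<tau> permutes coupled_edges" and y: "\<And>q. q \<in> coupled_edges \<Longrightarrow> y q < 2"
  shows "(\<forall>i\<in>single_edges. \<forall>t s. occupant_type \<tau> i t s \<longrightarrow> y (coupled_pos i t) = 1 - of_bool (t = s)) \<longleftrightarrow>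
    (\<forall>p\<in>coupled_edges. [y (\<tau> p) = b_type p + b_type (\<tau> p)] (mod 2))"
    (is "?L \<longleftrightarrow> ?R")
proof -
  have key: "y (coupled_pos i t) = 1 - of_bool (t = s) \<longleftrightarrow>
      [y (coupled_pos i t) = b_type (coupled_pos j s) + b_type (coupled_pos i t)] (mod 2)"
    if "i \<in> single_edges" "j \<in> single_edges" for i j t s
    using y[OF coupled_pos(2)[OF that(1), of t]] coupled_pos(3)[OF that(1), of t]
      coupled_pos(3)[OF that(2), of s]
    by (cases t; cases s) (auto simp: cong_def)
  show ?thesis
  proof
    assume L: ?L
    show ?R
    proof
      fix p assume "p \<in> coupled_edges"
      moreover from this have "\<tau> p \<in> coupled_edges" using \<tau> by (simp add: permutes_in_image)
      ultimately obtain i t j s where *: "i \<in> single_edges" "\<tau> p = coupled_pos i t"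
        "j \<in> single_edges" "p = coupled_pos j s" by (metis coupled_posE)
      then have "occupant_type \<tau> i t s" by (auto simp: occupant_type_def)
      then show "[y (\<tau> p) = b_type p + b_type (\<tau> p)] (mod 2)"
        using L * key[OF *(1,3), of t s] by simp
    qed
  next
    assume R: ?R
    show ?L
    proof (intro ballI allI impI)
      fix i t s assume i: "i \<in> single_edges" and "occupant_type \<tau> i t s"
      then obtain j where j: "j \<in> single_edges" "\<tau> (coupled_pos j s) = coupled_pos i t"
        by (auto simp: occupant_type_def)
      then show "y (coupled_pos i t) = 1 - of_bool (t = s)"
        using R key[OF i j(1), of t s] coupled_pos(2)[OF j(1), of s] by fastforce
    qed
  qed
qed

lemma placement_initial: "placement initial_config = id"
proof
  fix s :: sticker
  obtain p d where s: "s = (p, d)" by (cases s)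
  show "placement initial_config s = id s"
    by (auto simp: s placement_def initial_config_def stickers_iff put_self)
qed

theorem theorem5:
  fixes \<sigma> \<tau> \<tau>\<^sub>1 \<rho>\<^sub>c \<rho>\<^sub>e :: "vec \<Rightarrow> vec"
    and x y z :: "vec \<Rightarrow> nat"
  assumes "(\<sigma>, \<tau>, \<tau>\<^sub>1, \<rho>\<^sub>c, \<rho>\<^sub>e, x, y, z) \<in> configurations"
  shows "valid (\<sigma>, \<tau>, \<tau>\<^sub>1, \<rho>\<^sub>c, \<rho>\<^sub>e, x, y, z) \<longleftrightarrow>
    (sign \<sigma> = sign \<tau> \<and> sign \<tau> = sign \<rho>\<^sub>c) \<and>
    sign \<tau>\<^sub>1 = sign \<sigma> * sign \<rho>\<^sub>e \<and>
    [(\<Sum>i\<in>corners. x i) = 0] (mod 3) \<and>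
    [(\<Sum>i\<in>single_edges. z i) = 0] (mod 2) \<and>
    (\<forall>i\<in>single_edges. \<forall>t s. occupant_type \<tau>\<^sub>1 i t s \<longrightarrow>
       y (coupled_pos i t) = 1 - of_bool (t = s))"
proof -
  let ?c = "(\<sigma>, \<tau>, \<tau>\<^sub>1, \<rho>\<^sub>c, \<rho>\<^sub>e, x, y, z)"
  have perms: "\<sigma> permutes corners" "\<tau> permutes single_edges" "\<tau>\<^sub>1 permutes coupled_edges"
    "\<rho>\<^sub>c permutes center_corners" "\<rho>\<^sub>e permutes center_edges"
    and y: "y \<in> coupled_edges \<rightarrow>\<^sub>E {..<2}"
    using assms by (auto simp: configurations_def)
  define \<pi> where "\<pi> = \<sigma> \<circ> \<tau> \<circ> \<tau>\<^sub>1 \<circ> \<rho>\<^sub>c \<circ> \<rho>\<^sub>e"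
  define w where "w q = (if q \<in> corners then x q else if q \<in> single_edges then z q else
    if q \<in> coupled_edges then y q else 0)" for q
  have l: "layout \<pi>"
    unfolding \<pi>_def using perms by (intro layout_comp) (auto intro: layout_if_permutes_kind)
  have fixed: "abs_coords p \<noteq> [2,2,2] \<Longrightarrow> \<sigma> p = p" "abs_coords p \<noteq> [0,2,2] \<Longrightarrow> \<tau> p = p"
    "abs_coords p \<noteq> [1,2,2] \<Longrightarrow> \<tau>\<^sub>1 p = p" "abs_coords p \<noteq> [1,1,2] \<Longrightarrow> \<rho>\<^sub>c p = p"
    "abs_coords p \<noteq> [0,1,2] \<Longrightarrow> \<rho>\<^sub>e p = p" for p
    using perms by (auto simp: kind_defs permutes_def)
  have shape: "abs_coords (\<sigma> p) = abs_coords p" "abs_coords (\<tau> p) = abs_coords p"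
    "abs_coords (\<tau>\<^sub>1 p) = abs_coords p" "abs_coords (\<rho>\<^sub>c p) = abs_coords p"
    "abs_coords (\<rho>\<^sub>e p) = abs_coords p" for p
    using perms[THEN layout_if_permutes_kind] by (auto simp: layout_def)
  have \<pi>: "\<pi> p = (if p \<in> corners then \<sigma> p else if p \<in> single_edges then \<tau> p else
      if p \<in> coupled_edges then \<tau>\<^sub>1 p else if p \<in> center_corners then \<rho>\<^sub>c p else
      if p \<in> center_edges then \<rho>\<^sub>e p else p)" for p
    by (auto simp: \<pi>_def kind_defs fixed shape)
  have "placement ?c = arrange \<pi> w"
  proof
    fix s :: sticker
    obtain p d where s: "s = (p, d)" by (cases s)
    show "placement ?c s = arrange \<pi> w s"
    proof (cases "(p, d) \<in> stickers")
      case True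
      then show ?thesis
        by (auto simp: s placement_def arrange_def stickers_iff pieces_def \<pi> w_def kind_defs shape)
    next
      case False
      then show ?thesis
        using pieces_subset_cube by (auto simp: s placement_def arrange_def stickers_iff)
    qed
  qed
  then have "valid ?c \<longleftrightarrow> arrange \<pi> w \<in> G5"
    by (auto simp: valid_def placement_initial)
  also have "\<dots> \<longleftrightarrow> legal \<pi> w" using arrange_in_G5_iff[OF l] .
  finally have valid: "valid ?c \<longleftrightarrow> legal \<pi> w" .
  have restr: "perm_restrict \<pi> corners = \<sigma>" "perm_restrict \<pi> single_edges = \<tau>"
    "perm_restrict \<pi> coupled_edges = \<tau>\<^sub>1" "perm_restrict \<pi> center_corners = \<rho>\<^sub>c"
    "perm_restrict \<pi> center_edges = \<rho>\<^sub>e"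
    using fixed by (auto simp: fun_eq_iff perm_restrict_def \<pi> kind_defs)
  have sums: "(\<Sum>q\<in>corners. w q) = (\<Sum>q\<in>corners. x q)" "(\<Sum>q\<in>single_edges. w q) = (\<Sum>q\<in>single_edges. z q)"
    by (auto simp: w_def kind_defs intro!: sum.cong)
  have coupled: "(\<forall>p\<in>coupled_edges. [w (\<pi> p) = b_type p + b_type (\<pi> p)] (mod 2)) \<longleftrightarrow>
      (\<forall>p\<in>coupled_edges. [y (\<tau>\<^sub>1 p) = b_type p + b_type (\<tau>\<^sub>1 p)] (mod 2))"
    by (auto simp: \<pi> w_def kind_defs shape)
  have "y q < 2" if "q \<in> coupled_edges" for q using y that by auto
  then show ?thesis
    unfolding valid legal_def restr sums coupled
    using occupant_condition[OF perms(3), of y] by auto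
qed

end
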